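(* Let $\Lambda$ be a row-finite $k$-graph with no sources, $R$ a commutative ring with $1$, and $\mathcal{M}$ the cycline subalgebra of ${\rm KP}_R(\Lambda)$. If $\Phi:{\rm KP}_R(\Lambda)\to A$ is a ring homomorphism into a ring $A$, then $\Phi$ is injective if and only if the restriction $\Phi|_{\mathcal{M}}$ is injective.
   Context: A $k$-graph is a countable category $\Lambda$ (vertices $\Lambda^0$, paths, maps $r,s$) with a degree functor $d:\Lambda\to\mathbb{N}^k$ satisfying unique factorization: if $d(\lambda)=m+n$ there are unique $\mu,\nu$ with $s(\mu)=r(\nu)$, $d(\mu)=m,d(\nu)=n$, $\lambda=\mu\nu$. $v\Lambda=\{\lambda:r(\lambda)=v\}$, $v\Lambda^n$ those of degree $n$; row-finite with no sources means each $v\Lambda^n$ is finite and nonempty. ${\rm KP}_R(\Lambda)$ is the universal $R$-algebra generated by $p_v$ ($v\in\Lambda^0$), $s_\lambda,s_{\lambda^*}$ ($d(\lambda)\ne0$) with relations (KP1) $p_v$ mutually orthogonal idempotents; (KP2) $s_\lambda s_\mu=s_{\lambda\mu}$, $s_{\mu^*}s_{\lambda^*}=s_{(\lambda\mu)^*}$, $p_{r(\lambda)}s_\lambda=s_\lambda=s_\lambda p_{s(\lambda)}$, $p_{s(\lambda)}s_{\lambda^*}=s_{\lambda^*}=s_{\lambda^*}p_{r(\lambda)}$ when $r(\mu)=s(\lambda)$; (KP3) $s_{\lambda^*}s_\mu=\delta_{\lambda,\mu}p_{s(\lambda)}$ when $d(\lambda)=d(\mu)$; (KP4) $p_v=\sum_{\lambda\in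 v\Lambda^n}s_\lambda s_{\lambda^*}$ for $n\ne0$. Convention $s_v=s_{v^*}=p_v$. A pair $(\alpha,\beta)$ with $s(\alpha)=s(\beta)$ is a cycline pair if $s_{\alpha\gamma}s_{(\alpha\gamma)^*}=s_{\beta\gamma}s_{(\beta\gamma)^*}$ for all $\gamma\in s(\alpha)\Lambda$. The cycline subalgebra $\mathcal{M}$ is the $R$-subalgebra generated by $\{s_\alpha s_{\beta^*}: (\alpha,\beta)\text{ cycline}\}$. *)

theory Defs
  imports Main "HOL-Library.Countable_Set"
begin

text \<open>A k-graph: a (small) category whose morphisms ("paths") live in a carrier set,
  with objects (vertices) identified with identity morphisms, range/source maps,
  a partial composition (meaningful when s mu = r nu; "comp mu nu" is mu nu),
  and a degree functor into N^k, where N^k is represented by functions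
  nat => nat vanishing from index k on.\<close>

record 'p kgraph =
  paths :: "'p set"
  verts :: "'p set"
  rng   :: "'p \<Rightarrow> 'p"
  src   :: "'p \<Rightarrow> 'p"
  comp  :: "'p \<Rightarrow> 'p \<Rightarrow> 'p"
  deg   :: "'p \<Rightarrow> nat \<Rightarrow> nat"

definition in_Nk :: "nat \<Rightarrow> (nat \<Rightarrow> nat) \<Rightarrow> bool" where
  "in_Nk k n \<longleftrightarrow> (\<forall>i\<ge>k. n i = 0)"

definition addv :: "(nat \<Rightarrow> nat) \<Rightarrow> (nat \<Rightarrow> nat) \<Rightarrow> nat \<Rightarrow> nat" where
  "addv m n = (\<lambda>i. m i + n i)"

definition zerov :: "nat \<Rightarrow> nat" where
  "zerov = (\<lambda>_. 0)"

definition is_kgraph :: "'p kgraph \<Rightarrow> nat \<Rightarrow> bool" where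
  "is_kgraph G k \<longleftrightarrow>
     countable (paths G) \<and>
     verts G \<subseteq> paths G \<and>
     (\<forall>l\<in>paths G. rng G l \<in> verts G \<and> src G l \<in> verts G) \<and>
     (\<forall>v\<in>verts G. rng G v = v \<and> src G v = v) \<and>
     (\<forall>m\<in>paths G. \<forall>n\<in>paths G. src G m = rng G n \<longrightarrow>
        comp G m n \<in> paths G \<and> rng G (comp G m n) = rng G m \<and> src G (comp G m n) = src G n) \<and>
     (\<forall>a\<in>paths G. \<forall>b\<in>paths G. \<forall>c\<in>paths G. src G a = rng G b \<longrightarrow> src G b = rng G c \<longrightarrow>
        comp G (comp G a b) c = comp G a (comp G b c)) \<and>
     (\<forall>l\<in>paths G. comp G (rng G l) l = l \<and> comp G l (src G l) = l) \<and>
     (\<forall>l\<in>paths G. in_Nk k (deg G l)) \<and>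
     (\<forall>v\<in>verts G. deg G v = zerov) \<and>
     (\<forall>m\<in>paths G. \<forall>n\<in>paths G. src G m = rng G n \<longrightarrow>
        deg G (comp G m n) = addv (deg G m) (deg G n)) \<and>
     (\<forall>l\<in>paths G. \<forall>m n. deg G l = addv m n \<longrightarrow>
        (\<exists>!(a, b). a \<in> paths G \<and> b \<in> paths G \<and> src G a = rng G b \<and>
                   deg G a = m \<and> deg G b = n \<and> l = comp G a b))"

definition vLn :: "'p kgraph \<Rightarrow> 'p \<Rightarrow> (nat \<Rightarrow> nat) \<Rightarrow> 'p set" where
  "vLn G v n = {l \<in> paths G. rng G l = v \<and> deg G l = n}"

definition row_finite_no_sources :: "'p kgraph \<Rightarrow> nat \<Rightarrow> bool" where
  "row_finite_no_sources G k \<longleftrightarrow>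
     (\<forall>v\<in>verts G. \<forall>n. in_Nk k n \<longrightarrow> finite (vLn G v n) \<and> vLn G v n \<noteq> {})"

datatype 'p kpgen = GP 'p | GS 'p | GSs 'p

definition valid_gen :: "'p kgraph \<Rightarrow> 'p kpgen \<Rightarrow> bool" where
  "valid_gen G g = (case g of
      GP v \<Rightarrow> v \<in> verts G
    | GS l \<Rightarrow> l \<in> paths G \<and> deg G l \<noteq> zerov
    | GSs l \<Rightarrow> l \<in> paths G \<and> deg G l \<noteq> zerov)"

text \<open>Elements: finitely supported R-valued functions on nonempty words of valid generators.\<close>
type_synonym ('p, 'r) fa = "'p kpgen list \<Rightarrow> 'r"

definition fa_carrier :: "'p kgraph \<Rightarrow> ('p, 'r::comm_ring_1) fa set" where
  "fa_carrier G = {f. finite {w. f w \<noteq> 0} \<and>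
      (\<forall>w. f w \<noteq> 0 \<longrightarrow> w \<noteq> [] \<and> (\<forall>g\<in>set w. valid_gen G g))}"

definition fa_zero :: "('p, 'r::comm_ring_1) fa" where
  "fa_zero = (\<lambda>_. 0)"

definition fa_add :: "('p, 'r::comm_ring_1) fa \<Rightarrow> ('p, 'r) fa \<Rightarrow> ('p, 'r) fa" where
  "fa_add f g = (\<lambda>w. f w + g w)"

definition fa_sub :: "('p, 'r::comm_ring_1) fa \<Rightarrow> ('p, 'r) fa \<Rightarrow> ('p, 'r) fa" where
  "fa_sub f g = (\<lambda>w. f w - g w)"

definition fa_smult :: "'r::comm_ring_1 \<Rightarrow> ('p, 'r) fa \<Rightarrow> ('p, 'r) fa" where
  "fa_smult c f = (\<lambda>w. c * f w)"

definition fa_mult :: "('p, 'r::comm_ring_1) fa \<Rightarrow> ('p, 'r) fa \<Rightarrow> ('p, 'r) fa" where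
  "fa_mult f g = (\<lambda>w. \<Sum>i\<in>{1..<length w}. f (take i w) * g (drop i w))"

definition fa_gen :: "'p kpgen \<Rightarrow> ('p, 'r::comm_ring_1) fa" where
  "fa_gen g = (\<lambda>w. if w = [g] then 1 else 0)"

definition fa_sum :: "'i set \<Rightarrow> ('i \<Rightarrow> ('p, 'r::comm_ring_1) fa) \<Rightarrow> ('p, 'r) fa" where
  "fa_sum S F = (\<lambda>w. \<Sum>x\<in>S. F x w)"

text \<open>s_lambda and s_lambda^*, with the convention s_v = s_v^* = p_v.\<close>
definition sg :: "'p kgraph \<Rightarrow> 'p \<Rightarrow> ('p, 'r::comm_ring_1) fa" where
  "sg G l = fa_gen (if l \<in> verts G then GP l else GS l)"

definition ss :: "'p kgraph \<Rightarrow> 'p \<Rightarrow> ('p, 'r::comm_ring_1) fa" where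
  "ss G l = fa_gen (if l \<in> verts G then GP l else GSs l)"

definition pv :: "'p \<Rightarrow> ('p, 'r::comm_ring_1) fa" where
  "pv v = fa_gen (GP v)"

definition kp_rels :: "'p kgraph \<Rightarrow> nat \<Rightarrow> ('p, 'r::comm_ring_1) fa set" where
  "kp_rels G k =
     \<comment> \<open>KP1\<close>
     {fa_sub (fa_mult (pv v) (pv w)) (if v = w then pv v else fa_zero) | v w.
        v \<in> verts G \<and> w \<in> verts G}
   \<union> \<comment> \<open>KP2, products\<close>
     {fa_sub (fa_mult (sg G l) (sg G m)) (sg G (comp G l m)) | l m.
        l \<in> paths G \<and> m \<in> paths G \<and> deg G l \<noteq> zerov \<and> deg G m \<noteq> zerov \<and> rng G m = src G l}
   \<union> {fa_sub (fa_mult (ss G m) (ss G l)) (ss G (comp G l m)) | l m.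
        l \<in> paths G \<and> m \<in> paths G \<and> deg G l \<noteq> zerov \<and> deg G m \<noteq> zerov \<and> rng G m = src G l}
   \<union> \<comment> \<open>KP2, vertex projections\<close>
     {fa_sub (fa_mult (pv (rng G l)) (sg G l)) (sg G l) | l. l \<in> paths G \<and> deg G l \<noteq> zerov}
   \<union> {fa_sub (fa_mult (sg G l) (pv (src G l))) (sg G l) | l. l \<in> paths G \<and> deg G l \<noteq> zerov}
   \<union> {fa_sub (fa_mult (pv (src G l)) (ss G l)) (ss G l) | l. l \<in> paths G \<and> deg G l \<noteq> zerov}
   \<union> {fa_sub (fa_mult (ss G l) (pv (rng G l))) (ss G l) | l. l \<in> paths G \<and> deg G l \<noteq> zerov}
   \<union> \<comment> \<open>KP3\<close>
     {fa_sub (fa_mult (ss G l) (sg G m)) (if l = m then pv (src G l) else fa_zero) | l m.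
        l \<in> paths G \<and> m \<in> paths G \<and> deg G l = deg G m}
   \<union> \<comment> \<open>KP4\<close>
     {fa_sub (pv v) (fa_sum (vLn G v n) (\<lambda>l. fa_mult (sg G l) (ss G l))) | v n.
        v \<in> verts G \<and> in_Nk k n \<and> n \<noteq> zerov}"

inductive_set kp_ideal :: "'p kgraph \<Rightarrow> nat \<Rightarrow> ('p, 'r::comm_ring_1) fa set"
  for G :: "'p kgraph" and k :: nat where
  rel: "x \<in> kp_rels G k \<Longrightarrow> x \<in> kp_ideal G k"
| zero: "fa_zero \<in> kp_ideal G k"
| add: "x \<in> kp_ideal G k \<Longrightarrow> y \<in> kp_ideal G k \<Longrightarrow> fa_add x y \<in> kp_ideal G k"
| smult: "x \<in> kp_ideal G k \<Longrightarrow> fa_smult c x \<in> kp_ideal G k"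
| multl: "x \<in> kp_ideal G k \<Longrightarrow> w \<in> fa_carrier G \<Longrightarrow> fa_mult w x \<in> kp_ideal G k"
| multr: "x \<in> kp_ideal G k \<Longrightarrow> w \<in> fa_carrier G \<Longrightarrow> fa_mult x w \<in> kp_ideal G k"

definition kp_class :: "'p kgraph \<Rightarrow> nat \<Rightarrow> ('p, 'r::comm_ring_1) fa \<Rightarrow> ('p, 'r) fa set" where
  "kp_class G k x = {y \<in> fa_carrier G. fa_sub x y \<in> kp_ideal G k}"

definition KP :: "'p kgraph \<Rightarrow> nat \<Rightarrow> ('p, 'r::comm_ring_1) fa set set" where
  "KP G k = kp_class G k ` fa_carrier G"

definition kp_rep :: "('p, 'r::comm_ring_1) fa set \<Rightarrow> ('p, 'r) fa" where
  "kp_rep X = (SOME x. x \<in> X)"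

definition kp_zero :: "'p kgraph \<Rightarrow> nat \<Rightarrow> ('p, 'r::comm_ring_1) fa set" where
  "kp_zero G k = kp_class G k fa_zero"

definition kp_add :: "'p kgraph \<Rightarrow> nat \<Rightarrow> ('p, 'r::comm_ring_1) fa set \<Rightarrow> ('p, 'r) fa set \<Rightarrow> ('p, 'r) fa set" where
  "kp_add G k X Y = kp_class G k (fa_add (kp_rep X) (kp_rep Y))"

definition kp_mult :: "'p kgraph \<Rightarrow> nat \<Rightarrow> ('p, 'r::comm_ring_1) fa set \<Rightarrow> ('p, 'r) fa set \<Rightarrow> ('p, 'r) fa set" where
  "kp_mult G k X Y = kp_class G k (fa_mult (kp_rep X) (kp_rep Y))"

definition kp_smult :: "'p kgraph \<Rightarrow> nat \<Rightarrow> 'r::comm_ring_1 \<Rightarrow> ('p, 'r) fa set \<Rightarrow> ('p, 'r) fa set" where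
  "kp_smult G k c X = kp_class G k (fa_smult c (kp_rep X))"

definition kp_ssstar :: "'p kgraph \<Rightarrow> nat \<Rightarrow> 'p \<Rightarrow> 'p \<Rightarrow> ('p, 'r::comm_ring_1) fa set" where
  "kp_ssstar G k a b = kp_class G k (fa_mult (sg G a) (ss G b))"

definition cycline_pair :: "'p kgraph \<Rightarrow> nat \<Rightarrow> 'p \<Rightarrow> 'p \<Rightarrow> 'r::comm_ring_1 itself \<Rightarrow> bool" where
  "cycline_pair G k a b (_ :: 'r itself) \<longleftrightarrow>
     a \<in> paths G \<and> b \<in> paths G \<and> src G a = src G b \<and>
     (\<forall>g\<in>paths G. rng G g = src G a \<longrightarrow>
        (kp_ssstar G k (comp G a g) (comp G a g) :: ('p, 'r) fa set)
          = kp_ssstar G k (comp G b g) (comp G b g))"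

inductive_set cycline_subalg :: "'p kgraph \<Rightarrow> nat \<Rightarrow> ('p, 'r::comm_ring_1) fa set set"
  for G :: "'p kgraph" and k :: nat where
  gen: "cycline_pair G k a b TYPE('r) \<Longrightarrow> (kp_ssstar G k a b :: ('p, 'r) fa set) \<in> cycline_subalg G k"
| zero: "kp_zero G k \<in> cycline_subalg G k"
| add: "X \<in> cycline_subalg G k \<Longrightarrow> Y \<in> cycline_subalg G k \<Longrightarrow> kp_add G k X Y \<in> cycline_subalg G k"
| mult: "X \<in> cycline_subalg G k \<Longrightarrow> Y \<in> cycline_subalg G k \<Longrightarrow> kp_mult G k X Y \<in> cycline_subalg G k"
| smult: "X \<in> cycline_subalg G k \<Longrightarrow> kp_smult G k c X \<in> cycline_subalg G k"

end

theory Submission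
  imports Defs "HOL-Library.Function_Algebras"
begin

text \<open>Given a nonzero \<open>x\<close> in the kernel, multiply on the right by some \<open>s\<^sub>b\<close> of large degree,
  so that \<open>x s\<^sub>b\<close> is a nonzero combination of distinct \<open>s\<^sub>a\<close> with \<open>s(a) = s(b)\<close>. Fix \<open>a0\<close> in
  its support \<open>F\<close>, and choose a path \<open>t\<close> with range \<open>s(b)\<close> that minimizes the number of \<open>a\<close> in
  \<open>F\<close> for which \<open>a0 t\<close> and \<open>a t\<close> have a common extension. For such an \<open>a\<close>, minimality forces
  \<open>a0 t d\<close> and \<open>a t d\<close> to have a common extension for every \<open>d\<close>, and then every pair \<open>(r, s)\<close>
  with \<open>a0 t r = a t s\<close> is cycline; for the other \<open>a\<close> the product of \<open>(s\<^bsub>a0 t\<^esub>)*\<close> and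
  \<open>s\<^bsub>a t\<^esub>\<close> vanishes. Hence multiplying \<open>x s\<^sub>b\<close> by \<open>(s\<^bsub>a0 t\<^esub>)*\<close> on the left and by
  \<open>s\<^sub>t\<close> on the right gives an element of the cycline subalgebra. It is nonzero because the
  Kumjian-Pask algebra acts on the functions on finite paths modulo those vanishing on all paths
  of large degree, and the coefficient at \<open>a0\<close> can be recovered from this action.\<close>

section \<open>Arithmetic of the free algebra\<close>

notation fa_mult (infixl "\<odot>" 70)

lemmas fun_apply = plus_fun_apply zero_fun_apply minus_apply uminus_apply
\<comment> \<open>as rewrite rules these would break up eta-expanded elements of the algebra\<close>
declare fun_apply [simp del]

text \<open>Identifying the additive operations with the pointwise ones of the function type makes
  its abelian group laws and \<open>sum\<close> available. The product stays separate, because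
  \<open>fa_mult\<close> is convolution over splittings of words.\<close>

lemma fa_ops [simp]:
  "fa_add f g = f + g" "fa_sub f g = f - g" "fa_zero = 0"
  by (auto simp: fa_add_def fa_sub_def fa_zero_def fun_apply)

lemma sum_fun_apply: "(\<Sum>x\<in>S. F x) w = (\<Sum>x\<in>S. F x w :: 'b::comm_monoid_add)"
  by (induction S rule: infinite_finite_induct) (auto simp: fun_apply)

lemma fa_sum_eq [simp]: "fa_sum S F = sum F S"
  by (auto simp: fa_sum_def sum_fun_apply)

lemma fa_smult_simps [simp]:
  "fa_smult 0 a = 0" "fa_smult c 0 = 0" "fa_smult 1 a = a"
  "fa_smult c (fa_smult d a) = fa_smult (c * d) a"
  by (auto simp: fa_smult_def mult.assoc fun_apply)

lemma fa_smult_add: "fa_smult c (a + b) = fa_smult c a + fa_smult c b"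
  and fa_smult_diff: "fa_smult c (a - b) = fa_smult c a - fa_smult c b"
  and fa_smult_add_left: "fa_smult (c + d) a = fa_smult c a + fa_smult d a"
  by (auto simp: fa_smult_def algebra_simps fun_apply)

lemma fa_smult_minus_one: "fa_smult (-1) a = - a"
  by (auto simp: fa_smult_def fun_apply)

lemma fa_mult_add_left: "(a + b) \<odot> c = a \<odot> c + b \<odot> c"
  and fa_mult_add_right: "c \<odot> (a + b) = c \<odot> a + c \<odot> b"
  and fa_mult_diff_left: "(a - b) \<odot> c = a \<odot> c - b \<odot> c"
  and fa_mult_diff_right: "c \<odot> (a - b) = c \<odot> a - c \<odot> b"
  by (auto simp: fa_mult_def algebra_simps fun_apply sum.distrib sum_subtractf)

lemma fa_mult_zero [simp]: "0 \<odot> a = 0" "a \<odot> 0 = 0"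
  by (auto simp: fa_mult_def fun_apply)

lemma fa_mult_smult_left: "fa_smult c a \<odot> b = fa_smult c (a \<odot> b)"
  and fa_mult_smult_right: "a \<odot> fa_smult c b = fa_smult c (a \<odot> b)"
  by (auto simp: fa_mult_def fa_smult_def sum_distrib_left algebra_simps)

lemma fa_mult_sum_left: "sum F S \<odot> c = (\<Sum>x\<in>S. F x \<odot> c)"
  by (induction S rule: infinite_finite_induct) (simp_all add: fa_mult_add_left)

lemma fa_mult_sum_right: "c \<odot> sum F S = (\<Sum>x\<in>S. c \<odot> F x)"
  by (induction S rule: infinite_finite_induct) (simp_all add: fa_mult_add_right)

text \<open>Both sides sum over the ways to cut \<open>w\<close> into three nonempty pieces. The
  left side is indexed by the two cut positions, the right side by the first cut and the length of
  the middle piece, and the bijection translates between these.\<close>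

lemma fa_mult_assoc: "a \<odot> b \<odot> c = a \<odot> (b \<odot> c)"
proof
  fix w :: "'a kpgen list"
  let ?n = "length w"
  let ?t = "\<lambda>i j. a (take i w) * b (take (j - i) (drop i w)) * c (drop j w)"
  have "(a \<odot> b \<odot> c) w = (\<Sum>j\<in>{1..<?n}. \<Sum>i\<in>{1..<j}. ?t i j)"
    unfolding fa_mult_def sum_distrib_right
    by (intro sum.cong) (auto simp: min_def drop_take)
  also have "\<dots> = (\<Sum>(j,i)\<in>(SIGMA j:{1..<?n}. {1..<j}). ?t i j)"
    by (subst sum.Sigma) auto
  also have "\<dots> = (\<Sum>(i,l)\<in>(SIGMA i:{1..<?n}. {1..<?n - i}). ?t i (i + l))"
    by (rule sum.reindex_bij_witness[where i = "\<lambda>(i,l). (i + l, i)" and j = "\<lambda>(j,i). (i, j - i)"])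
       auto
  also have "\<dots> = (\<Sum>i\<in>{1..<?n}. \<Sum>l\<in>{1..<?n - i}. ?t i (i + l))"
    by (subst sum.Sigma) auto
  also have "\<dots> = (a \<odot> (b \<odot> c)) w"
    unfolding fa_mult_def sum_distrib_left
    by (intro sum.cong) (auto simp: algebra_simps)
  finally show "(a \<odot> b \<odot> c) w = (a \<odot> (b \<odot> c)) w" .
qed

section \<open>Monomials and the finitely supported carrier\<close>

definition word :: "'p kpgen list \<Rightarrow> ('p, 'r::comm_ring_1) fa" where
  "word w = (\<lambda>u. if u = w then 1 else 0)"

lemma fa_gen_eq_word: "fa_gen g = word [g]"
  by (auto simp: fa_gen_def word_def)

text \<open>The range \<open>{1..<length w}\<close> in \<open>fa_mult\<close> cuts words into
  nonempty pieces only, so \<open>word []\<close> multiplies to zero instead of acting as a unit.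
  Hence both factors must be nonempty.\<close>

lemma word_append:
  assumes "u \<noteq> []" "v \<noteq> []"
  shows "word (u @ v) = word u \<odot> word v"
proof
  fix w
  have "(word u \<odot> word v) w
      = (\<Sum>i\<in>{1..<length w}. if i = length u \<and> w = u @ v then 1 else 0)"
    unfolding fa_mult_def word_def
    by (intro sum.cong) (auto simp: min_def split: if_splits)
  also have "\<dots> = word (u @ v) w"
    using assms by (auto simp: word_def Suc_le_eq)
  finally show "word (u @ v) w = (word u \<odot> word v) w" by (rule sym)
qed

lemma carrier_zero [simp]: "0 \<in> fa_carrier G"
  by (simp add: fa_carrier_def fun_apply)

lemma carrier_add [simp]: "a \<in> fa_carrier G \<Longrightarrow> b \<in> fa_carrier G \<Longrightarrow> a + b \<in> fa_carrier G"
  unfolding fa_carrier_def fun_apply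
  by (auto intro!: finite_subset[of _ "{w. a w \<noteq> 0} \<union> {w. b w \<noteq> 0}"]) (metis add.left_neutral)+

lemma carrier_smult [simp]: "a \<in> fa_carrier G \<Longrightarrow> fa_smult c a \<in> fa_carrier G"
proof -
  assume a: "a \<in> fa_carrier G"
  have "{w. c * a w \<noteq> 0} \<subseteq> {w. a w \<noteq> 0}" by auto
  with a show ?thesis
    unfolding fa_carrier_def fa_smult_def by (auto intro: finite_subset)
qed

lemma carrier_diff [simp]:
  assumes "a \<in> fa_carrier G" "b \<in> fa_carrier G" shows "a - b \<in> fa_carrier G"
  using carrier_add[OF assms(1) carrier_smult[OF assms(2), of "-1"]]
  by (simp add: fa_smult_minus_one)

lemma carrier_sum [simp]: "(\<And>x. x \<in> S \<Longrightarrow> F x \<in> fa_carrier G) \<Longrightarrow> sum F S \<in> fa_carrier G"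
  by (induction S rule: infinite_finite_induct) simp_all

lemma fa_mult_nonzeroE:
  assumes "(a \<odot> b) w \<noteq> 0"
  obtains u v where "w = u @ v" "a u \<noteq> 0" "b v \<noteq> 0"
proof -
  obtain i where "a (take i w) * b (drop i w) \<noteq> 0"
    using assms unfolding fa_mult_def by (meson sum.not_neutral_contains_not_neutral)
  then have "a (take i w) \<noteq> 0" "b (drop i w) \<noteq> 0" by auto
  then show thesis using that[of "take i w" "drop i w"] by simp
qed

lemma carrier_mult [simp]:
  assumes "a \<in> fa_carrier G" "b \<in> fa_carrier G" shows "a \<odot> b \<in> fa_carrier G"
proof -
  have "{w. (a \<odot> b) w \<noteq> 0} \<subseteq> (\<lambda>(u, v). u @ v) ` ({w. a w \<noteq> 0} \<times> {w. b w \<noteq> 0})"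
    by (auto elim!: fa_mult_nonzeroE)
  moreover have "finite ({w. a w \<noteq> 0} \<times> {w. b w \<noteq> 0})"
    using assms by (auto simp: fa_carrier_def)
  ultimately have "finite {w. (a \<odot> b) w \<noteq> 0}" by (rule finite_surj[rotated])
  moreover have "w \<noteq> [] \<and> (\<forall>g\<in>set w. valid_gen G g)" if "(a \<odot> b) w \<noteq> 0" for w
    using that assms by (elim fa_mult_nonzeroE) (auto simp: fa_carrier_def)
  ultimately show ?thesis by (simp add: fa_carrier_def)
qed

lemma carrier_word [simp]: "w \<noteq> [] \<Longrightarrow> \<forall>g\<in>set w. valid_gen G g \<Longrightarrow> word w \<in> fa_carrier G"
  by (auto simp: fa_carrier_def word_def)

text \<open>Reduces linear statements about the carrier to monomials; \<open>word_induct\<close>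
  later reduces those to generators.\<close>

lemma carrier_induct [consumes 1, case_names zero add]:
  assumes "a \<in> fa_carrier G"
    and zero: "P 0"
    and add: "\<And>a c w. a \<in> fa_carrier G \<Longrightarrow> P a \<Longrightarrow> w \<noteq> [] \<Longrightarrow> \<forall>g\<in>set w. valid_gen G g
               \<Longrightarrow> P (a + fa_smult c (word w))"
  shows "P a"
proof -
  \<comment> \<open>The induction runs over a finite set containing the support, so that the element
    with one coefficient erased is covered by the smaller set.\<close>
  have "finite A \<Longrightarrow> a \<in> fa_carrier G \<Longrightarrow> {w. a w \<noteq> 0} \<subseteq> A \<Longrightarrow> P a" for A a
  proof (induction A arbitrary: a rule: finite_induct)
    case empty
    then have "a = 0" by (intro ext) (auto simp: fun_apply)
    then show ?case using zero by (simp only:)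
  next
    case (insert w A)
    show ?case
    proof (cases "a w = 0")
      case True
      then show ?thesis using insert by blast
    next
      case False
      let ?b = "a(w := 0)"
      have b: "?b \<in> fa_carrier G"
        using insert.prems(1) unfolding fa_carrier_def
        by (auto intro: finite_subset[of _ "{w. a w \<noteq> 0}"])
      moreover have "P ?b" using insert.prems by (intro insert.IH[OF b]) auto
      moreover have "w \<noteq> []" "\<forall>g\<in>set w. valid_gen G g"
        using insert.prems False by (auto simp: fa_carrier_def)
      ultimately have "P (?b + fa_smult (a w) (word w))" by (rule add)
      moreover have "?b + fa_smult (a w) (word w) = a"
        by (auto simp: fa_smult_def word_def fun_apply)
      ultimately show ?thesis by simp
    qed
  qed
  then show ?thesis using assms(1) by (auto simp: fa_carrier_def)
qed

lemma addv_cancel [simp]: "addv m n = addv m n' \<longleftrightarrow> n = n'" "addv m n = addv m' n \<longleftrightarrow> m = m'"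
  by (auto simp: addv_def fun_eq_iff)

section \<open>Factorizations in a k-graph\<close>

locale row_finite_kgraph =
  fixes G :: "'p kgraph" and k :: nat
  assumes kgraph: "is_kgraph G k" and row_finite: "row_finite_no_sources G k"
begin

abbreviation "C \<equiv> fa_carrier G"
abbreviation "src' \<equiv> src G"
abbreviation "rng' \<equiv> rng G"
abbreviation "deg' \<equiv> deg G"
abbreviation "V \<equiv> verts G"
abbreviation "\<Lambda> \<equiv> paths G"
abbreviation cmp (infixl "\<cdot>" 75) where "a \<cdot> b \<equiv> comp G a b"

lemmas kgraph_axiom1 = kgraph[unfolded is_kgraph_def, THEN conjunct2]
lemmas kgraph_axiom2 = kgraph_axiom1[THEN conjunct2]
lemmas kgraph_axiom3 = kgraph_axiom2[THEN conjunct2]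
lemmas kgraph_axiom4 = kgraph_axiom3[THEN conjunct2]
lemmas kgraph_axiom5 = kgraph_axiom4[THEN conjunct2]
lemmas kgraph_axiom6 = kgraph_axiom5[THEN conjunct2]
lemmas kgraph_axiom7 = kgraph_axiom6[THEN conjunct2]
lemmas kgraph_axiom8 = kgraph_axiom7[THEN conjunct2]
lemmas kgraph_axiom9 = kgraph_axiom8[THEN conjunct2]

lemma vert_path [simp]: "v \<in> V \<Longrightarrow> v \<in> \<Lambda>"
  and rng_vert [simp]: "l \<in> \<Lambda> \<Longrightarrow> rng' l \<in> V"
  and src_vert [simp]: "l \<in> \<Lambda> \<Longrightarrow> src' l \<in> V"
  and rng_of_vert [simp]: "v \<in> V \<Longrightarrow> rng' v = v"
  and src_of_vert [simp]: "v \<in> V \<Longrightarrow> src' v = v"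
  and cmp_path [simp]: "a \<in> \<Lambda> \<Longrightarrow> b \<in> \<Lambda> \<Longrightarrow> src' a = rng' b \<Longrightarrow> a \<cdot> b \<in> \<Lambda>"
  and rng_cmp [simp]: "a \<in> \<Lambda> \<Longrightarrow> b \<in> \<Lambda> \<Longrightarrow> src' a = rng' b \<Longrightarrow> rng' (a \<cdot> b) = rng' a"
  and src_cmp [simp]: "a \<in> \<Lambda> \<Longrightarrow> b \<in> \<Lambda> \<Longrightarrow> src' a = rng' b \<Longrightarrow> src' (a \<cdot> b) = src' b"
  and cmp_rng [simp]: "a \<in> \<Lambda> \<Longrightarrow> rng' a \<cdot> a = a"
  and cmp_src [simp]: "a \<in> \<Lambda> \<Longrightarrow> a \<cdot> src' a = a"
  and deg_vert [simp]: "v \<in> V \<Longrightarrow> deg' v = zerov"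
  and in_Nk_deg [simp]: "a \<in> \<Lambda> \<Longrightarrow> in_Nk k (deg' a)"
  and deg_cmp [simp]: "a \<in> \<Lambda> \<Longrightarrow> b \<in> \<Lambda> \<Longrightarrow> src' a = rng' b \<Longrightarrow> deg' (a \<cdot> b) = addv (deg' a) (deg' b)"
  using kgraph_axiom1[THEN conjunct1] kgraph_axiom2[THEN conjunct1] kgraph_axiom3[THEN conjunct1] kgraph_axiom4[THEN conjunct1]
    kgraph_axiom6[THEN conjunct1] kgraph_axiom7[THEN conjunct1] kgraph_axiom8[THEN conjunct1] kgraph_axiom9[THEN conjunct1]
  by (simp_all add: subset_iff)

lemma cmp_assoc: "a \<in> \<Lambda> \<Longrightarrow> b \<in> \<Lambda> \<Longrightarrow> c \<in> \<Lambda> \<Longrightarrow> src' a = rng' b \<Longrightarrow> src' b = rng' c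
    \<Longrightarrow> a \<cdot> b \<cdot> c = a \<cdot> (b \<cdot> c)"
  using kgraph_axiom5[THEN conjunct1] by simp

lemma unique_factorization:
  assumes "l \<in> \<Lambda>" "deg' l = addv m n"
  shows "\<exists>!(a, b). a \<in> \<Lambda> \<and> b \<in> \<Lambda> \<and> src' a = rng' b \<and> deg' a = m \<and> deg' b = n \<and> l = a \<cdot> b"
  using assms kgraph_axiom9[THEN conjunct2] by simp

text \<open>Additivity of the degree makes the second factors agree in degree as well, so both pairs
  are factorizations of one path of the same type and uniqueness identifies them.\<close>

lemma cmp_cancel:
  assumes "a \<in> \<Lambda>" "b \<in> \<Lambda>" "c \<in> \<Lambda>" "d \<in> \<Lambda>" "src' a = rng' b" "src' c = rng' d"
    and "a \<cdot> b = c \<cdot> d" "deg' a = deg' c"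
  shows "a = c \<and> b = d"
proof -
  have "addv (deg' a) (deg' b) = addv (deg' c) (deg' d)"
    using assms deg_cmp by metis
  then have d: "deg' b = deg' d"
    using assms(8) by simp
  let ?P = "\<lambda>(x, y). x \<in> \<Lambda> \<and> y \<in> \<Lambda> \<and> src' x = rng' y \<and> deg' x = deg' a \<and> deg' y = deg' b \<and> a \<cdot> b = x \<cdot> y"
  have "\<exists>!p. ?P p"
    using assms(1,2,5) by (intro unique_factorization) simp_all
  moreover have "?P (a, b)" "?P (c, d)" using assms(1-6,8) d by (simp_all add: assms(7))
  ultimately have "(a, b) = (c, d)" by blast
  then show ?thesis by simp
qed

lemma cmp_left_cancel:
  "a \<in> \<Lambda> \<Longrightarrow> b \<in> \<Lambda> \<Longrightarrow> d \<in> \<Lambda> \<Longrightarrow> src' a = rng' b \<Longrightarrow> src' a = rng' d \<Longrightarrow> a \<cdot> b = a \<cdot> d \<longleftrightarrow> b = d"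
  using cmp_cancel[of a b a d] by auto

lemma cmp_right_cancel:
  assumes "a \<in> \<Lambda>" "b \<in> \<Lambda>" "c \<in> \<Lambda>" "src' a = rng' b" "src' c = rng' b" "a \<cdot> b = c \<cdot> b"
  shows "a = c"
proof -
  have "addv (deg' a) (deg' b) = addv (deg' c) (deg' b)"
    using assms deg_cmp by metis
  then have "deg' a = deg' c"
    by simp
  then show ?thesis using cmp_cancel[of a b c b] assms by simp
qed

text \<open>Compare the factorizations \<open>r(l) l\<close> and \<open>l s(l)\<close> of
  \<open>l\<close>: all factors have degree zero, so uniqueness gives
  \<open>r(l) = l\<close>.\<close>

lemma vertI:
  assumes "l \<in> \<Lambda>" "deg' l = zerov" shows "l \<in> V"
proof -
  have "rng' l \<cdot> l = l \<cdot> src' l" using assms by simp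
  then have "rng' l = l"
    using cmp_cancel[of "rng' l" l l "src' l"] assms by (simp del: cmp_rng cmp_src)
  then show ?thesis using rng_vert[OF assms(1)] by simp
qed

lemma vert_iff: "l \<in> \<Lambda> \<Longrightarrow> l \<in> V \<longleftrightarrow> deg' l = zerov"
  using vertI by auto

lemma factorE:
  assumes "l \<in> \<Lambda>" "n \<le> deg' l"
  obtains a b where "a \<in> \<Lambda>" "b \<in> \<Lambda>" "src' a = rng' b" "deg' a = n" "l = a \<cdot> b"
proof -
  have "deg' l = addv n (\<lambda>i. deg' l i - n i)"
    using assms(2) by (auto simp: addv_def le_fun_def)
  from unique_factorization[OF assms(1) this] show thesis using that by blast
qed

definition extends :: "'p \<Rightarrow> 'p \<Rightarrow> bool" where
  "extends m l \<longleftrightarrow> (\<exists>n\<in>\<Lambda>. src' l = rng' n \<and> m = l \<cdot> n)"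

lemma extends_cmp: "l \<in> \<Lambda> \<Longrightarrow> n \<in> \<Lambda> \<Longrightarrow> src' l = rng' n \<Longrightarrow> extends (l \<cdot> n) l"
  unfolding extends_def by auto

lemma finite_vLn [simp]: "v \<in> V \<Longrightarrow> in_Nk k n \<Longrightarrow> finite (vLn G v n)"
  and vLn_nonempty: "v \<in> V \<Longrightarrow> in_Nk k n \<Longrightarrow> vLn G v n \<noteq> {}"
  using row_finite unfolding row_finite_no_sources_def by auto

lemma vLnD: "l \<in> vLn G v n \<Longrightarrow> l \<in> \<Lambda> \<and> rng' l = v \<and> deg' l = n"
  by (simp add: vLn_def)

text \<open>Cut \<open>d\<close> at the degree of \<open>a\<close>. The first piece and
  \<open>a\<close> are then initial segments of equal degree of the same path, hence equal.\<close>

lemma prefix_of_prefix: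
  assumes "a \<in> \<Lambda>" "e \<in> \<Lambda>" "d \<in> \<Lambda>" "h \<in> \<Lambda>" "src' a = rng' e" "src' d = rng' h"
    and "a \<cdot> e = d \<cdot> h" "deg' a \<le> deg' d"
  shows "extends d a"
proof -
  obtain b c where bc: "b \<in> \<Lambda>" "c \<in> \<Lambda>" "src' b = rng' c" "deg' b = deg' a" "d = b \<cdot> c"
    by (rule factorE[OF assms(3,8)])
  have c: "src' c = rng' h" using assms(6) bc by simp
  have "d \<cdot> h = b \<cdot> (c \<cdot> h)"
    unfolding bc(5) using bc(1-3) assms(4) c by (simp add: cmp_assoc)
  then have "a \<cdot> e = b \<cdot> (c \<cdot> h)" using assms(7) by simp
  then have "a = b \<and> e = c \<cdot> h"
    using assms(1,2,4,5) bc(1-4) c by (intro cmp_cancel) simp_all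
  then show ?thesis unfolding bc(5) using extends_cmp[OF bc(1-3)] by simp
qed

section \<open>Congruence modulo the Kumjian-Pask relations\<close>

abbreviation I where "I \<equiv> kp_ideal G k"
abbreviation S where "S \<equiv> sg G"
abbreviation T where "T \<equiv> ss G"

text \<open>Calculations are done with representatives modulo the ideal, which keeps the choice
  \<open>kp_rep\<close> out of them and allows \<open>also\<close> chains. Classes return only
  through \<open>cls\<close>.\<close>

definition cong :: "('p, 'r::comm_ring_1) fa \<Rightarrow> ('p, 'r) fa \<Rightarrow> bool" (infix "\<approx>" 50) where
  "a \<approx> b \<longleftrightarrow> a - b \<in> I"

lemma pv_eq: "v \<in> V \<Longrightarrow> pv v = S v" "v \<in> V \<Longrightarrow> T v = S v"
  by (auto simp: sg_def ss_def pv_def)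

lemma carrier_S [simp]: "l \<in> \<Lambda> \<Longrightarrow> S l \<in> C"
  and carrier_T [simp]: "l \<in> \<Lambda> \<Longrightarrow> T l \<in> C"
  by (auto simp: sg_def ss_def fa_gen_eq_word valid_gen_def vert_iff)

lemma carrier_pv [simp]: "v \<in> V \<Longrightarrow> pv v \<in> C"
  by (simp add: pv_eq)

lemma ideal_zero [simp]: "0 \<in> I"
  and ideal_add: "a \<in> I \<Longrightarrow> b \<in> I \<Longrightarrow> a + b \<in> I"
  and ideal_smult: "a \<in> I \<Longrightarrow> fa_smult c a \<in> I"
  and ideal_mult_left: "a \<in> I \<Longrightarrow> b \<in> C \<Longrightarrow> b \<odot> a \<in> I"
  and ideal_mult_right: "a \<in> I \<Longrightarrow> b \<in> C \<Longrightarrow> a \<odot> b \<in> I"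
  using kp_ideal.zero kp_ideal.add[of a G k b] kp_ideal.smult[of a G k c]
    kp_ideal.multl[of a G k b] kp_ideal.multr[of a G k b] by simp_all

lemma ideal_uminus: "a \<in> I \<Longrightarrow> - a \<in> I"
  using ideal_smult[of a "-1"] by (simp add: fa_smult_minus_one)

lemma ideal_sum: "(\<And>x. x \<in> A \<Longrightarrow> f x \<in> I) \<Longrightarrow> sum f A \<in> I"
  by (induction A rule: infinite_finite_induct) (simp_all add: ideal_add)

lemma rels_carrier: "kp_rels G k \<subseteq> C"
  unfolding kp_rels_def by (auto; intro carrier_diff carrier_sum carrier_mult; simp add: vLn_def)

lemma ideal_carrier: "a \<in> I \<Longrightarrow> a \<in> C"
proof (induction rule: kp_ideal.induct)
  case (rel x)
  then show ?case using rels_carrier by blast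
qed simp_all

lemma cong_refl [simp]: "a \<approx> a"
  by (simp add: cong_def)

lemma cong_sym: "a \<approx> b \<Longrightarrow> b \<approx> a"
  unfolding cong_def using ideal_uminus[of "a - b"] by simp

lemma cong_trans [trans]: "a \<approx> b \<Longrightarrow> b \<approx> c \<Longrightarrow> a \<approx> c"
  unfolding cong_def using ideal_add[of "a - b" "b - c"] by simp

lemma cong_eq_trans [trans]: "a \<approx> b \<Longrightarrow> b = c \<Longrightarrow> a \<approx> c" "a = b \<Longrightarrow> b \<approx> c \<Longrightarrow> a \<approx> c"
  by simp_all

lemma cong_add: "a \<approx> b \<Longrightarrow> c \<approx> d \<Longrightarrow> a + c \<approx> b + d"
  unfolding cong_def using ideal_add[of "a - b" "c - d"] by (simp add: algebra_simps)

lemma cong_smult: "a \<approx> b \<Longrightarrow> fa_smult c a \<approx> fa_smult c b"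
  unfolding cong_def using ideal_smult[of "a - b" c] by (simp add: fa_smult_diff)

lemma cong_sum: "(\<And>x. x \<in> A \<Longrightarrow> f x \<approx> g x) \<Longrightarrow> sum f A \<approx> sum g A"
  unfolding cong_def sum_subtractf[symmetric] by (rule ideal_sum)

lemma cong_mult_left: "a \<approx> b \<Longrightarrow> c \<in> C \<Longrightarrow> c \<odot> a \<approx> c \<odot> b"
  unfolding cong_def fa_mult_diff_right[symmetric] by (rule ideal_mult_left)

lemma cong_mult_right: "a \<approx> b \<Longrightarrow> c \<in> C \<Longrightarrow> a \<odot> c \<approx> b \<odot> c"
  unfolding cong_def fa_mult_diff_left[symmetric] by (rule ideal_mult_right)

lemma cong_mult: "a \<approx> b \<Longrightarrow> c \<approx> d \<Longrightarrow> a \<in> C \<Longrightarrow> d \<in> C \<Longrightarrow> a \<odot> c \<approx> b \<odot> d"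
  using cong_mult_left[of c d a] cong_mult_right[of a b d] cong_trans by blast

lemma cong_zero_iff: "a \<approx> 0 \<longleftrightarrow> a \<in> I"
  by (simp add: cong_def)

lemma cong_ideal_iff: "a \<approx> b \<Longrightarrow> a \<in> I \<longleftrightarrow> b \<in> I"
  by (metis cong_zero_iff cong_sym cong_trans)

lemma relI: "fa_sub a b \<in> kp_rels G k \<Longrightarrow> a \<approx> b"
  unfolding cong_def using kp_ideal.rel[of "fa_sub a b"] by simp

lemma KP1: "v \<in> V \<Longrightarrow> w \<in> V \<Longrightarrow> pv v \<odot> pv w \<approx> (if v = w then pv v else fa_zero)"
  by (rule relI, unfold kp_rels_def,
      rule UnI1, rule UnI1, rule UnI1, rule UnI1, rule UnI1, rule UnI1, rule UnI1, rule UnI1, blast)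

lemma KP2_S: "l \<in> \<Lambda> \<Longrightarrow> m \<in> \<Lambda> \<Longrightarrow> deg' l \<noteq> zerov \<Longrightarrow> deg' m \<noteq> zerov \<Longrightarrow> rng' m = src' l
    \<Longrightarrow> S l \<odot> S m \<approx> S (l \<cdot> m)"
  by (rule relI, unfold kp_rels_def,
      rule UnI1, rule UnI1, rule UnI1, rule UnI1, rule UnI1, rule UnI1, rule UnI1, rule UnI2, blast)

lemma KP2_T: "l \<in> \<Lambda> \<Longrightarrow> m \<in> \<Lambda> \<Longrightarrow> deg' l \<noteq> zerov \<Longrightarrow> deg' m \<noteq> zerov \<Longrightarrow> rng' m = src' l
    \<Longrightarrow> T m \<odot> T l \<approx> T (l \<cdot> m)"
  by (rule relI, unfold kp_rels_def,
      rule UnI1, rule UnI1, rule UnI1, rule UnI1, rule UnI1, rule UnI1, rule UnI2, blast)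

lemma KP2_rng_S: "l \<in> \<Lambda> \<Longrightarrow> deg' l \<noteq> zerov \<Longrightarrow> pv (rng' l) \<odot> S l \<approx> S l"
  by (rule relI, unfold kp_rels_def,
      rule UnI1, rule UnI1, rule UnI1, rule UnI1, rule UnI1, rule UnI2, blast)

lemma KP2_S_src: "l \<in> \<Lambda> \<Longrightarrow> deg' l \<noteq> zerov \<Longrightarrow> S l \<odot> pv (src' l) \<approx> S l"
  by (rule relI, unfold kp_rels_def,
      rule UnI1, rule UnI1, rule UnI1, rule UnI1, rule UnI2, blast)

lemma KP2_src_T: "l \<in> \<Lambda> \<Longrightarrow> deg' l \<noteq> zerov \<Longrightarrow> pv (src' l) \<odot> T l \<approx> T l"
  by (rule relI, unfold kp_rels_def,
      rule UnI1, rule UnI1, rule UnI1, rule UnI2, blast)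

lemma KP2_T_rng: "l \<in> \<Lambda> \<Longrightarrow> deg' l \<noteq> zerov \<Longrightarrow> T l \<odot> pv (rng' l) \<approx> T l"
  by (rule relI, unfold kp_rels_def,
      rule UnI1, rule UnI1, rule UnI2, blast)

lemma KP3: "l \<in> \<Lambda> \<Longrightarrow> m \<in> \<Lambda> \<Longrightarrow> deg' l = deg' m
    \<Longrightarrow> T l \<odot> S m \<approx> (if l = m then pv (src' l) else fa_zero)"
  by (rule relI, unfold kp_rels_def,
      rule UnI1, rule UnI2, blast)

lemma KP4: "v \<in> V \<Longrightarrow> in_Nk k n \<Longrightarrow> n \<noteq> zerov
    \<Longrightarrow> pv v \<approx> fa_sum (vLn G v n) (\<lambda>l. S l \<odot> T l)"
  by (rule relI, unfold kp_rels_def, rule UnI2, blast)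

text \<open>From here to \<open>S_vert_expand\<close> the relations are extended to paths of degree
  zero, using the convention s_v = s_v* = p_v, so that later arguments need not separate vertices
  from longer paths.\<close>

lemma S_vert_mult: "v \<in> V \<Longrightarrow> w \<in> V \<Longrightarrow> S v \<odot> S w \<approx> (if v = w then S v else 0)"
  using KP1[of v w] by (cases "v = w") (simp_all add: pv_eq)

lemma S_rng: assumes "l \<in> \<Lambda>" shows "S (rng' l) \<odot> S l \<approx> S l"
proof (cases "deg' l = zerov")
  case True
  then have "l \<in> V" using assms vertI by blast
  then show ?thesis using S_vert_mult[of l l] by simp
next
  case False
  then show ?thesis using KP2_rng_S[OF assms] assms by (simp add: pv_eq)
qed

lemma S_src: assumes "l \<in> \<Lambda>" shows "S l \<odot> S (src' l) \<approx> S l"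
proof (cases "deg' l = zerov")
  case True
  then have "l \<in> V" using assms vertI by blast
  then show ?thesis using S_vert_mult[of l l] by simp
next
  case False
  then show ?thesis using KP2_S_src[OF assms] assms by (simp add: pv_eq)
qed

lemma T_rng: assumes "l \<in> \<Lambda>" shows "T l \<odot> S (rng' l) \<approx> T l"
proof (cases "deg' l = zerov")
  case True
  then have "l \<in> V" using assms vertI by blast
  then show ?thesis using S_vert_mult[of l l] by (simp add: pv_eq)
next
  case False
  then show ?thesis using KP2_T_rng[OF assms] assms by (simp add: pv_eq)
qed

lemma T_src: assumes "l \<in> \<Lambda>" shows "S (src' l) \<odot> T l \<approx> T l"
proof (cases "deg' l = zerov")
  case True
  then have "l \<in> V" using assms vertI by blast
  then show ?thesis using S_vert_mult[of l l] by (simp add: pv_eq)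
next
  case False
  then show ?thesis using KP2_src_T[OF assms] assms by (simp add: pv_eq)
qed

lemma S_cmp:
  assumes "l \<in> \<Lambda>" "m \<in> \<Lambda>" "src' l = rng' m"
  shows "S l \<odot> S m \<approx> S (l \<cdot> m)"
proof -
  consider "l \<in> V" | "m \<in> V" | "deg' l \<noteq> zerov" "deg' m \<noteq> zerov"
    using assms vertI by blast
  then show ?thesis
  proof cases
    case 1
    then have "l = rng' m" using assms(3) by simp
    then show ?thesis using S_rng[OF assms(2)] assms(2) by simp
  next
    case 2
    then have "m = src' l" using assms(3) by simp
    then show ?thesis using S_src[OF assms(1)] assms(1) by simp
  next
    case 3
    then show ?thesis using KP2_S[OF assms(1,2)] assms(3) by simp
  qed
qed

lemma T_cmp:
  assumes "l \<in> \<Lambda>" "m \<in> \<Lambda>" "src' l = rng' m"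
  shows "T m \<odot> T l \<approx> T (l \<cdot> m)"
proof -
  consider "l \<in> V" | "m \<in> V" | "deg' l \<noteq> zerov" "deg' m \<noteq> zerov"
    using assms vertI by blast
  then show ?thesis
  proof cases
    case 1
    then have "l = rng' m" using assms(3) by simp
    then show ?thesis using T_rng[OF assms(2)] assms(2) by (simp add: pv_eq)
  next
    case 2
    then have "m = src' l" using assms(3) by simp
    then show ?thesis using T_src[OF assms(1)] assms(1) by (simp add: pv_eq)
  next
    case 3
    then show ?thesis using KP2_T[OF assms(1,2)] assms(3) by simp
  qed
qed

lemma T_S_eq_deg:
  assumes "l \<in> \<Lambda>" "m \<in> \<Lambda>" "deg' l = deg' m"
  shows "T l \<odot> S m \<approx> (if l = m then S (src' l) else 0)"
  using KP3[OF assms] assms by (auto simp: pv_eq split: if_splits)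

lemma S_vert_expand:
  assumes "v \<in> V" "in_Nk k n"
  shows "S v \<approx> (\<Sum>l\<in>vLn G v n. S l \<odot> T l)"
proof (cases "n = zerov")
  case True
  have "l = v" if "l \<in> vLn G v n" for l
    using vLnD[OF that] vertI[of l] rng_of_vert[of l] True by simp
  moreover have "v \<in> vLn G v n" using assms True by (simp add: vLn_def)
  ultimately have "vLn G v n = {v}" by blast
  then show ?thesis using assms S_vert_mult[of v v, THEN cong_sym] by (simp add: pv_eq)
next
  case False
  then show ?thesis using KP4[OF assms] assms by (simp add: pv_eq)
qed

text \<open>Insert the projections at \<open>s(l)\<close> and \<open>r(m)\<close> between the
  factors; they belong to distinct vertices and are therefore orthogonal.\<close>

lemma S_not_composable:
  assumes "l \<in> \<Lambda>" "m \<in> \<Lambda>" "src' l \<noteq> rng' m"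
  shows "S l \<odot> S m \<approx> 0"
proof -
  have "S l \<odot> S m \<approx> (S l \<odot> S (src' l)) \<odot> (S (rng' m) \<odot> S m)"
    using assms by (intro cong_mult S_src[THEN cong_sym] S_rng[THEN cong_sym]) simp_all
  also have "\<dots> = S l \<odot> (S (src' l) \<odot> S (rng' m) \<odot> S m)"
    by (simp add: fa_mult_assoc)
  also have "\<dots> \<approx> S l \<odot> (0 \<odot> S m)"
    using assms S_vert_mult[of "src' l" "rng' m"]
    by (intro cong_mult_left cong_mult_right) simp_all
  finally show ?thesis by simp
qed

lemma T_S_cmp:
  assumes "l \<in> \<Lambda>" "a \<in> \<Lambda>" "b \<in> \<Lambda>" "src' a = rng' b" "deg' l = deg' a"
  shows "T l \<odot> S (a \<cdot> b) \<approx> (if l = a then S b else 0)"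
proof -
  have "T l \<odot> S (a \<cdot> b) \<approx> T l \<odot> (S a \<odot> S b)"
    using assms by (intro cong_mult_left S_cmp[THEN cong_sym]) simp_all
  also have "\<dots> = T l \<odot> S a \<odot> S b" by (simp add: fa_mult_assoc)
  also have "\<dots> \<approx> (if l = a then S (src' l) else 0) \<odot> S b"
    using assms by (intro cong_mult_right T_S_eq_deg) simp_all
  also have "\<dots> \<approx> (if l = a then S b else 0)"
    using assms S_rng[of b] by auto
  finally show ?thesis .
qed

lemma T_cmp_S:
  assumes "l \<in> \<Lambda>" "a \<in> \<Lambda>" "b \<in> \<Lambda>" "src' a = rng' b" "deg' l = deg' a"
  shows "T (a \<cdot> b) \<odot> S l \<approx> (if l = a then T b else 0)"
proof -
  have "T (a \<cdot> b) \<odot> S l \<approx> T b \<odot> T a \<odot> S l"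
    using assms by (intro cong_mult_right T_cmp[THEN cong_sym]) simp_all
  also have "\<dots> = T b \<odot> (T a \<odot> S l)" by (simp add: fa_mult_assoc)
  also have "\<dots> \<approx> T b \<odot> (if a = l then S (src' a) else 0)"
    using assms by (intro cong_mult_left T_S_eq_deg) simp_all
  also have "\<dots> \<approx> (if l = a then T b else 0)"
    using assms T_rng[of b] by auto
  finally show ?thesis .
qed

section \<open>Expansion of products of generators at a prescribed degree\<close>

definition subv :: "(nat \<Rightarrow> nat) \<Rightarrow> (nat \<Rightarrow> nat) \<Rightarrow> nat \<Rightarrow> nat" where
  "subv m n = (\<lambda>i. m i - n i)"

lemma in_Nk_subv [simp]: "in_Nk k m \<Longrightarrow> in_Nk k (subv m n)"
  by (auto simp: in_Nk_def subv_def)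

lemma addv_subv [simp]: "n \<le> m \<Longrightarrow> addv n (subv m n) = m"
  by (auto simp: addv_def subv_def le_fun_def)

lemma subv_addv [simp]: "subv (addv n m) n = m"
  by (auto simp: addv_def subv_def)

text \<open>This set is empty or a singleton. As a set it lets \<open>T_S_tails\<close> write a
  product that is either one generator or zero as a single sum, without a case distinction.\<close>

definition tails :: "'p \<Rightarrow> 'p \<Rightarrow> 'p set" where
  "tails m b = {s \<in> \<Lambda>. src' b = rng' s \<and> m = b \<cdot> s}"

lemma tails_unique: "b \<in> \<Lambda> \<Longrightarrow> s \<in> tails m b \<Longrightarrow> t \<in> tails m b \<Longrightarrow> s = t"
  using cmp_left_cancel[of b s t] unfolding tails_def by simp

lemma finite_tails: "b \<in> \<Lambda> \<Longrightarrow> finite (tails m b)"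
  using tails_unique[of b _ m] by (metis finite.emptyI finite.insertI finite_subset insertCI subsetI)

text \<open>Cut \<open>m\<close> at the degree of \<open>b\<close>: by (KP3) the product vanishes
  unless the initial piece is \<open>b\<close> itself, and then only the remaining piece
  survives.\<close>

lemma T_S_tails:
  assumes "m \<in> \<Lambda>" "b \<in> \<Lambda>" "deg' b \<le> deg' m"
  shows "T m \<odot> S b \<approx> sum T (tails m b)"
proof -
  obtain b' s where f: "b' \<in> \<Lambda>" "s \<in> \<Lambda>" "src' b' = rng' s" "deg' b' = deg' b" "m = b' \<cdot> s"
    by (rule factorE[OF assms(1,3)])
  show ?thesis
  proof (cases "b = b'")
    case True
    then have "s \<in> tails m b" using f by (simp add: tails_def)
    then have "tails m b = {s}" using tails_unique[OF assms(2)] by blast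
    then show ?thesis
      using T_cmp_S[OF assms(2) f(1-3)] True by (simp add: f(5))
  next
    case False
    have "t \<notin> tails m b" for t
      using cmp_cancel[OF f(1,2) assms(2) _ f(3) _ _ f(4), of t] False f(5)
      by (auto simp: tails_def)
    then have "tails m b = {}" by blast
    then show ?thesis
      using T_cmp_S[OF assms(2) f(1-3) f(4)[symmetric]] False by (simp add: f(5))
  qed
qed

text \<open>Expand the projection at \<open>s(a)\<close> by (KP4) in degree \<open>n - d(a)\<close>.
  Each \<open>a r\<close> then has degree \<open>n\<close>, which dominates \<open>d(b)\<close>, so
  \<open>T_S_tails\<close> applies. The surviving pairs are those with \<open>a r = b s\<close> of
  degree \<open>n\<close>; for the join of the two degrees they are the minimal common
  extensions.\<close>

lemma T_S_expand:
  assumes "a \<in> \<Lambda>" "b \<in> \<Lambda>" "in_Nk k n" "deg' a \<le> n" "deg' b \<le> n"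
  shows "T a \<odot> S b \<approx> (\<Sum>(r, s)\<in>(SIGMA r:vLn G (src' a) (subv n (deg' a)). tails (a \<cdot> r) b). S r \<odot> T s)"
proof -
  let ?R = "vLn G (src' a) (subv n (deg' a))"
  have R: "r \<in> \<Lambda>" "src' a = rng' r" "deg' (a \<cdot> r) = n" if "r \<in> ?R" for r
    using vLnD[OF that] assms by auto
  have "T a \<odot> S b \<approx> S (src' a) \<odot> T a \<odot> S b"
    using assms by (intro cong_mult_right T_src[THEN cong_sym]) simp_all
  also have "\<dots> \<approx> (\<Sum>r\<in>?R. S r \<odot> T r) \<odot> T a \<odot> S b"
    using assms by (intro cong_mult_right S_vert_expand) simp_all
  also have "\<dots> = (\<Sum>r\<in>?R. S r \<odot> (T r \<odot> T a \<odot> S b))"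
    by (simp add: fa_mult_sum_left fa_mult_assoc)
  also have "\<dots> \<approx> (\<Sum>r\<in>?R. S r \<odot> (T (a \<cdot> r) \<odot> S b))"
    using assms R by (intro cong_sum cong_mult_left cong_mult_right T_cmp) simp_all
  also have "\<dots> \<approx> (\<Sum>r\<in>?R. S r \<odot> sum T (tails (a \<cdot> r) b))"
    using assms R by (intro cong_sum cong_mult_left T_S_tails) simp_all
  also have "\<dots> = (\<Sum>r\<in>?R. \<Sum>s\<in>tails (a \<cdot> r) b. S r \<odot> T s)"
    by (simp add: fa_mult_sum_right)
  also have "\<dots> = (\<Sum>(r, s)\<in>(SIGMA r:?R. tails (a \<cdot> r) b). S r \<odot> T s)"
    using assms by (intro sum.Sigma) (auto intro: finite_tails)
  finally show ?thesis .
qed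

text \<open>Depending only on the set of extensions of \<open>a\<close> in degree \<open>n\<close>,
  this turns equality of two range projections into equality of two sets of paths.\<close>

lemma S_T_expand:
  assumes "a \<in> \<Lambda>" "in_Nk k n" "deg' a \<le> n"
  shows "S a \<odot> T a \<approx> (\<Sum>l\<in>{l \<in> \<Lambda>. deg' l = n \<and> extends l a}. S l \<odot> T l)"
proof -
  let ?R = "vLn G (src' a) (subv n (deg' a))"
  have R: "r \<in> \<Lambda>" "src' a = rng' r" "deg' (a \<cdot> r) = n" if "r \<in> ?R" for r
    using vLnD[OF that] assms by auto
  have "S a \<odot> T a \<approx> S a \<odot> (S (src' a) \<odot> T a)"
    using assms by (intro cong_mult_left T_src[THEN cong_sym]) simp_all
  also have "\<dots> \<approx> S a \<odot> ((\<Sum>r\<in>?R. S r \<odot> T r) \<odot> T a)"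
    using assms by (intro cong_mult_left cong_mult_right S_vert_expand) simp_all
  also have "\<dots> = (\<Sum>r\<in>?R. (S a \<odot> S r) \<odot> (T r \<odot> T a))"
    by (simp add: fa_mult_sum_left fa_mult_sum_right fa_mult_assoc)
  also have "\<dots> \<approx> (\<Sum>r\<in>?R. S (a \<cdot> r) \<odot> T (a \<cdot> r))"
    using assms R by (intro cong_sum cong_mult T_cmp S_cmp) simp_all
  also have "\<dots> = (\<Sum>l\<in>(\<lambda>r. a \<cdot> r) ` ?R. S l \<odot> T l)"
    using assms R cmp_left_cancel[of a] by (subst sum.reindex) (auto simp: inj_on_def)
  also have "(\<lambda>r. a \<cdot> r) ` ?R = {l \<in> \<Lambda>. deg' l = n \<and> extends l a}"
    using assms by (auto simp: extends_def vLn_def) (metis)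
  finally show ?thesis .
qed

section \<open>Common extensions and cycline pairs\<close>

definition meets :: "'p \<Rightarrow> 'p \<Rightarrow> bool" where
  "meets a b \<longleftrightarrow> (\<exists>e\<in>\<Lambda>. \<exists>h\<in>\<Lambda>. src' a = rng' e \<and> src' b = rng' h \<and> a \<cdot> e = b \<cdot> h)"

lemma meets_sym: "meets a b \<Longrightarrow> meets b a"
  unfolding meets_def by metis

definition maxv :: "(nat \<Rightarrow> nat) \<Rightarrow> (nat \<Rightarrow> nat) \<Rightarrow> nat \<Rightarrow> nat" where
  "maxv m n = (\<lambda>i. max (m i) (n i))"

lemma maxv_simps [simp]: "m \<le> maxv m n" "n \<le> maxv m n" "in_Nk k m \<Longrightarrow> in_Nk k n \<Longrightarrow> in_Nk k (maxv m n)"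
  by (auto simp: maxv_def le_fun_def in_Nk_def)

lemma T_S_not_meets:
  assumes "a \<in> \<Lambda>" "b \<in> \<Lambda>" "\<not> meets a b"
  shows "T a \<odot> S b \<approx> 0"
proof -
  let ?n = "maxv (deg' a) (deg' b)"
  have "tails (a \<cdot> r) b = {}" if "r \<in> vLn G (src' a) (subv ?n (deg' a))" for r
  proof -
    have "r \<in> \<Lambda>" "src' a = rng' r" using vLnD[OF that] by simp_all
    then show ?thesis using assms(3) unfolding tails_def meets_def by blast
  qed
  then have "(SIGMA r:vLn G (src' a) (subv ?n (deg' a)). tails (a \<cdot> r) b) = {}"
    by blast
  then show ?thesis
    using T_S_expand[OF assms(1,2), of ?n] assms(1,2) by simp
qed

text \<open>The combinatorial core of the cycline property. A common extension of \<open>a l\<close>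
  and \<open>b l\<close>, rewritten with \<open>a r = b s\<close>, shows after cancelling
  \<open>b\<close> that \<open>l\<close> and \<open>s g\<close> are initial segments of one path;
  the degree bound makes \<open>s g\<close> the shorter one.\<close>

lemma extends_transfer:
  assumes a: "a \<in> \<Lambda>" "b \<in> \<Lambda>" "src' a = src' b"
    and meets: "\<And>d. d \<in> \<Lambda> \<Longrightarrow> rng' d = src' a \<Longrightarrow> meets (a \<cdot> d) (b \<cdot> d)"
    and r: "r \<in> \<Lambda>" "s \<in> \<Lambda>" "src' a = rng' r" "src' b = rng' s" "a \<cdot> r = b \<cdot> s"
    and g: "g \<in> \<Lambda>" "src' r = rng' g" "src' s = rng' g"
    and l: "l \<in> \<Lambda>" "extends l (r \<cdot> g)" "deg' (s \<cdot> g) \<le> deg' l"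
  shows "extends l (s \<cdot> g)"
proof -
  obtain e where e: "e \<in> \<Lambda>" "src' g = rng' e" "l = r \<cdot> g \<cdot> e"
    using l(2) r(1) g(1,2) unfolding extends_def by auto
  have lr: "rng' l = rng' r" "src' l = src' e" unfolding e(3) using r(1) g(1,2) e(1,2) by simp_all
  \<comment> \<open>The hypothesis is used with \<open>d = l\<close>, whose range is
    \<open>r(r) = s(a)\<close>.\<close>
  have "meets (a \<cdot> l) (b \<cdot> l)"
    using meets[OF l(1)] lr r(3) by simp
  then obtain h h' where h: "h \<in> \<Lambda>" "h' \<in> \<Lambda>" "src' l = rng' h" "src' l = rng' h'"
    "a \<cdot> l \<cdot> h = b \<cdot> l \<cdot> h'"
    unfolding meets_def using a l(1) lr r(3) by auto
  have eh: "src' e = rng' h" using lr(2) h(3) by simp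
  have sg: "s \<cdot> g \<in> \<Lambda>" "src' (s \<cdot> g) = src' g" "rng' (s \<cdot> g) = src' b"
    using r(2,4) g(1,3) by simp_all
  have "b \<cdot> (l \<cdot> h') = a \<cdot> l \<cdot> h"
    unfolding h(5) using a(2,3) l(1) h(2,4) lr(1) r(3) by (simp add: cmp_assoc)
  also have "\<dots> = a \<cdot> (l \<cdot> h)"
    using a(1) l(1) h(1,3) lr(1) r(3) by (simp add: cmp_assoc)
  also have "l \<cdot> h = r \<cdot> (g \<cdot> (e \<cdot> h))"
    unfolding e(3) using r(1) g(1,2) e(1,2) h(1) eh by (simp add: cmp_assoc)
  also have "a \<cdot> \<dots> = b \<cdot> s \<cdot> (g \<cdot> (e \<cdot> h))"
    unfolding r(5)[symmetric] using a(1) r(1,3) g(1,2) e(1,2) h(1) eh by (simp add: cmp_assoc)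
  also have "\<dots> = b \<cdot> (s \<cdot> g \<cdot> (e \<cdot> h))"
    using a(2) r(2,4) g(1,3) e(1,2) h(1) eh by (simp add: cmp_assoc)
  finally have "b \<cdot> (l \<cdot> h') = b \<cdot> (s \<cdot> g \<cdot> (e \<cdot> h))" .
  then have "l \<cdot> h' = s \<cdot> g \<cdot> (e \<cdot> h)"
    by (rule cmp_left_cancel[THEN iffD1, rotated -1])
      (use a(2,3) l(1) h(1,2,4) lr(1) r(3) sg e(1,2) eh in simp_all)
  then have "s \<cdot> g \<cdot> (e \<cdot> h) = l \<cdot> h'" by (rule sym)
  then show ?thesis
    by (rule prefix_of_prefix[rotated -2])
      (use l(1,3) h(1,2,4) sg e(1,2) eh in simp_all)
qed

section \<open>Classes in the quotient and membership in the cycline subalgebra\<close>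

abbreviation cls where "cls \<equiv> kp_class G k"

lemma cls_eqI: "x \<approx> y \<Longrightarrow> cls x = cls y"
  unfolding kp_class_def fa_ops cong_def[symmetric] using cong_sym cong_trans by blast

lemma cls_mem: "x \<in> C \<Longrightarrow> x \<in> cls x"
  by (simp add: kp_class_def)

lemma cls_eq_iff: "y \<in> C \<Longrightarrow> cls x = cls y \<longleftrightarrow> x \<approx> y"
  using cls_eqI cls_mem[of y] unfolding kp_class_def fa_ops cong_def[symmetric] by blast

lemma kp_rep:
  assumes "x \<in> C" shows "kp_rep (cls x) \<in> C" "kp_rep (cls x) \<approx> x"
proof -
  have "kp_rep (cls x) \<in> cls x"
    unfolding kp_rep_def by (rule someI[of _ x]) (rule cls_mem[OF assms])
  then show "kp_rep (cls x) \<in> C" "kp_rep (cls x) \<approx> x"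
    unfolding kp_class_def by (simp_all add: cong_def[symmetric] cong_sym)
qed

lemma kp_add_cls: "x \<in> C \<Longrightarrow> y \<in> C \<Longrightarrow> kp_add G k (cls x) (cls y) = cls (x + y)"
  and kp_mult_cls: "x \<in> C \<Longrightarrow> y \<in> C \<Longrightarrow> kp_mult G k (cls x) (cls y) = cls (x \<odot> y)"
  and kp_smult_cls: "x \<in> C \<Longrightarrow> kp_smult G k c (cls x) = cls (fa_smult c x)"
  unfolding kp_add_def kp_mult_def kp_smult_def fa_ops
  by (intro cls_eqI cong_add cong_mult cong_smult kp_rep; simp)+

lemma cycline_pairI:
  fixes ty :: "'r::comm_ring_1 itself"
  assumes a: "a \<in> \<Lambda>" "b \<in> \<Lambda>" "src' a = src' b"
    and meets: "\<And>d. d \<in> \<Lambda> \<Longrightarrow> rng' d = src' a \<Longrightarrow> meets (a \<cdot> d) (b \<cdot> d)"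
    and r: "r \<in> \<Lambda>" "s \<in> \<Lambda>" "src' a = rng' r" "src' b = rng' s" "a \<cdot> r = b \<cdot> s"
  shows "cycline_pair G k r s ty"
  unfolding cycline_pair_def
proof (intro conjI ballI impI)
  have "src' (a \<cdot> r) = src' (b \<cdot> s)" by (simp only: r(5))
  then show src: "src' r = src' s" using a r(1-4) by simp
  fix g assume g: "g \<in> \<Lambda>" "rng' g = src' r"
  then have rg: "src' r = rng' g" "src' s = rng' g" using src by simp_all
  \<comment> \<open>A degree above both, so that the two range projections can be expanded over
    paths of one common degree.\<close>
  let ?n = "maxv (deg' (r \<cdot> g)) (deg' (s \<cdot> g))"
  have p: "r \<cdot> g \<in> \<Lambda>" "s \<cdot> g \<in> \<Lambda>" using r g(1) rg by simp_all
  then have n: "in_Nk k ?n" by simp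
  \<comment> \<open>The hypotheses are symmetric under exchanging \<open>(a, r)\<close> with
    \<open>(b, s)\<close>, so \<open>extends_transfer\<close> yields both inclusions.\<close>
  have "{l \<in> \<Lambda>. deg' l = ?n \<and> extends l (r \<cdot> g)} = {l \<in> \<Lambda>. deg' l = ?n \<and> extends l (s \<cdot> g)}"
  proof (intro equalityI subsetI)
    fix l assume "l \<in> {l \<in> \<Lambda>. deg' l = ?n \<and> extends l (r \<cdot> g)}"
    then have l: "l \<in> \<Lambda>" "deg' l = ?n" "extends l (r \<cdot> g)" by blast+
    have "extends l (s \<cdot> g)"
      by (rule extends_transfer[OF a meets r g(1) rg l(1,3)]) (simp_all only: l(2) maxv_simps)
    then show "l \<in> {l \<in> \<Lambda>. deg' l = ?n \<and> extends l (s \<cdot> g)}" using l by blast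
  next
    fix l assume "l \<in> {l \<in> \<Lambda>. deg' l = ?n \<and> extends l (s \<cdot> g)}"
    then have l: "l \<in> \<Lambda>" "deg' l = ?n" "extends l (s \<cdot> g)" by blast+
    have meets': "meets (b \<cdot> d) (a \<cdot> d)" if "d \<in> \<Lambda>" "rng' d = src' b" for d
      using meets[of d] that a(3) meets_sym by metis
    have "extends l (r \<cdot> g)"
      by (rule extends_transfer[OF a(2,1) a(3)[symmetric] meets' r(2,1,4,3) r(5)[symmetric] g(1) rg(2,1) l(1,3)])
        (simp_all only: l(2) maxv_simps)
    then show "l \<in> {l \<in> \<Lambda>. deg' l = ?n \<and> extends l (r \<cdot> g)}" using l by blast
  qed
  then have "(S (r \<cdot> g) \<odot> T (r \<cdot> g) :: ('p, 'r) fa)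
      \<approx> (\<Sum>l\<in>{l \<in> \<Lambda>. deg' l = ?n \<and> extends l (s \<cdot> g)}. S l \<odot> T l)"
    using S_T_expand[OF p(1) n maxv_simps(1)] by (simp only:)
  also have "\<dots> \<approx> S (s \<cdot> g) \<odot> T (s \<cdot> g)"
    by (rule cong_sym[OF S_T_expand[OF p(2) n maxv_simps(2)]])
  finally have "(S (r \<cdot> g) \<odot> T (r \<cdot> g) :: ('p, 'r) fa) \<approx> S (s \<cdot> g) \<odot> T (s \<cdot> g)" .
  then show "(kp_ssstar G k (r \<cdot> g) (r \<cdot> g) :: ('p, 'r) fa set) = kp_ssstar G k (s \<cdot> g) (s \<cdot> g)"
    unfolding kp_ssstar_def by (rule cls_eqI)
qed (rule r)+

definition cycline :: "('p, 'r::comm_ring_1) fa \<Rightarrow> bool" where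
  "cycline x \<longleftrightarrow> x \<in> C \<and> cls x \<in> cycline_subalg G k"

lemma cycline_zero: "cycline 0"
  using cycline_subalg.zero[of G k] by (simp add: cycline_def kp_zero_def)

lemma cycline_add: "cycline x \<Longrightarrow> cycline y \<Longrightarrow> cycline (x + y)"
  using cycline_subalg.add[of "cls x" G k "cls y"] by (simp add: cycline_def kp_add_cls)

lemma cycline_smult: "cycline x \<Longrightarrow> cycline (fa_smult c x)"
  using cycline_subalg.smult[of "cls x" G k c] by (simp add: cycline_def kp_smult_cls)

lemma cycline_sum: "(\<And>i. i \<in> A \<Longrightarrow> cycline (f i)) \<Longrightarrow> cycline (sum f A)"
  by (induction A rule: infinite_finite_induct) (simp_all add: cycline_zero cycline_add)

lemma cycline_cong: "cycline x \<Longrightarrow> y \<in> C \<Longrightarrow> x \<approx> y \<Longrightarrow> cycline y"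
  unfolding cycline_def using cls_eqI by metis

text \<open>Every pair \<open>(r, s)\<close> occurring in \<open>T_S_expand\<close> satisfies
  \<open>a r = b s\<close> and is cycline by \<open>cycline_pairI\<close>, so the expansion is a sum
  of generators of the subalgebra.\<close>

lemma cycline_T_S:
  assumes a: "a \<in> \<Lambda>" "b \<in> \<Lambda>" "src' a = src' b"
    and meets: "\<And>d. d \<in> \<Lambda> \<Longrightarrow> rng' d = src' a \<Longrightarrow> meets (a \<cdot> d) (b \<cdot> d)"
  shows "cycline (T a \<odot> S b :: ('p, 'r::comm_ring_1) fa)"
proof -
  let ?n = "maxv (deg' a) (deg' b)"
  let ?A = "SIGMA r:vLn G (src' a) (subv ?n (deg' a)). tails (a \<cdot> r) b"
  have "cycline (S r \<odot> T s :: ('p, 'r) fa)" if "(r, s) \<in> ?A" for r s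
  proof -
    have rs: "r \<in> \<Lambda>" "s \<in> \<Lambda>" "src' a = rng' r" "src' b = rng' s" "a \<cdot> r = b \<cdot> s"
      using that unfolding tails_def vLn_def by auto
    from cycline_subalg.gen[OF cycline_pairI[OF a meets rs]]
    show ?thesis using rs by (simp add: cycline_def kp_ssstar_def)
  qed
  then have sum: "cycline (\<Sum>(r, s)\<in>?A. S r \<odot> T s :: ('p, 'r) fa)"
    by (intro cycline_sum) auto
  have "(T a \<odot> S b :: ('p, 'r) fa) \<approx> (\<Sum>(r, s)\<in>?A. S r \<odot> T s)"
    using a(1,2) by (intro T_S_expand) simp_all
  from cycline_cong[OF sum _ cong_sym[OF this]] show ?thesis
    using a(1,2) by simp
qed

section \<open>Right multiplication by generators of large degree\<close>

text \<open>Only coordinates below \<open>k\<close> are bounded, since degrees vanish from index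
  \<open>k\<close> on.\<close>

definition deg_ge :: "nat \<Rightarrow> 'p \<Rightarrow> bool" where
  "deg_ge N l \<longleftrightarrow> (\<forall>i<k. N \<le> deg' l i)"

lemma deg_ge_add: "deg_ge (M + N) l \<Longrightarrow> deg_ge M l" "deg_ge (M + N) l \<Longrightarrow> deg_ge N l"
  unfolding deg_ge_def by (meson add_leD1 add_leD2)+

text \<open>A single number dominating all coordinates of the degree, so that bounds can be added as
  natural numbers.\<close>

definition total_deg :: "'p \<Rightarrow> nat" where
  "total_deg l = (\<Sum>i<k. deg' l i)"

lemma deg_le_total_deg: "i < k \<Longrightarrow> deg' l i \<le> total_deg l"
  unfolding total_deg_def by (rule member_le_sum) simp_all

lemma deg_ge_total_deg:
  assumes "l \<in> \<Lambda>" "deg_ge (total_deg l) m" shows "deg' l \<le> deg' m"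
proof (rule le_funI)
  fix i
  show "deg' l i \<le> deg' m i"
  proof (cases "i < k")
    case True
    then show ?thesis using deg_le_total_deg[of i l] assms(2) unfolding deg_ge_def by force
  next
    case False
    then show ?thesis using in_Nk_deg[OF assms(1)] by (simp add: in_Nk_def)
  qed
qed

text \<open>Left multiplication by \<open>x\<close> sends generators of large degree to generators
  or zero. Bounding the loss of degree by \<open>N\<close> in each coordinate is what makes the
  property stable under products.\<close>

definition shifts :: "nat \<Rightarrow> ('p, 'r::comm_ring_1) fa \<Rightarrow> bool" where
  "shifts N x \<longleftrightarrow> (\<forall>b\<in>\<Lambda>. deg_ge N b \<longrightarrow> x \<odot> S b \<approx> 0 \<or>
     (\<exists>a\<in>\<Lambda>. src' a = src' b \<and> (\<forall>i<k. deg' b i \<le> deg' a i + N) \<and> x \<odot> S b \<approx> S a))"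

lemma shifts_S: "l \<in> \<Lambda> \<Longrightarrow> shifts N (S l :: ('p, 'r::comm_ring_1) fa)"
  unfolding shifts_def
proof (intro ballI impI)
  fix b assume b: "l \<in> \<Lambda>" "b \<in> \<Lambda>"
  show "(S l :: ('p, 'r) fa) \<odot> S b \<approx> 0 \<or>
     (\<exists>a\<in>\<Lambda>. src' a = src' b \<and> (\<forall>i<k. deg' b i \<le> deg' a i + N) \<and> (S l :: ('p, 'r) fa) \<odot> S b \<approx> S a)"
  proof (cases "src' l = rng' b")
    case True
    then have "(S l :: ('p, 'r) fa) \<odot> S b \<approx> S (l \<cdot> b)" "l \<cdot> b \<in> \<Lambda>" "src' (l \<cdot> b) = src' b"
      "\<forall>i<k. deg' b i \<le> deg' (l \<cdot> b) i + N"
      using b S_cmp by (simp_all add: addv_def)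
    then show ?thesis by blast
  next
    case False
    then show ?thesis using b S_not_composable by blast
  qed
qed

text \<open>Since \<open>d(l) \<le> d(b)\<close>, cut \<open>b\<close> at the degree of
  \<open>l\<close>: by (KP3) the product either strips the initial segment \<open>l\<close> or is
  zero.\<close>

lemma shifts_T: "l \<in> \<Lambda> \<Longrightarrow> shifts (total_deg l) (T l :: ('p, 'r::comm_ring_1) fa)"
  unfolding shifts_def
proof (intro ballI impI)
  fix b assume b: "l \<in> \<Lambda>" "b \<in> \<Lambda>" "deg_ge (total_deg l) b"
  obtain a s where f: "a \<in> \<Lambda>" "s \<in> \<Lambda>" "src' a = rng' s" "deg' a = deg' l" "b = a \<cdot> s"
    by (rule factorE[OF b(2) deg_ge_total_deg[OF b(1,3)]])
  have *: "(T l :: ('p, 'r) fa) \<odot> S b \<approx> (if l = a then S s else 0)"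
    unfolding f(5) by (rule T_S_cmp[OF b(1) f(1-3) f(4)[symmetric]])
  show "(T l :: ('p, 'r) fa) \<odot> S b \<approx> 0 \<or>
     (\<exists>a\<in>\<Lambda>. src' a = src' b \<and> (\<forall>i<k. deg' b i \<le> deg' a i + total_deg l) \<and> (T l :: ('p, 'r) fa) \<odot> S b \<approx> S a)"
  proof (cases "l = a")
    case True
    have "src' s = src' b" "deg' b = addv (deg' l) (deg' s)"
      unfolding f(5) using f(1-4) by simp_all
    then have "\<forall>i<k. deg' b i \<le> deg' s i + total_deg l"
      using deg_le_total_deg[of _ l] by (simp add: addv_def add.commute)
    then show ?thesis using * True f(2) \<open>src' s = src' b\<close> by auto
  next
    case False
    then show ?thesis using * by simp
  qed
qed

lemma shifts_mult:
  assumes "x \<in> C" "y \<in> C" "shifts M x" "shifts N y"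
  shows "shifts (M + N) (x \<odot> y)"
  unfolding shifts_def
proof (intro ballI impI)
  fix b assume b: "b \<in> \<Lambda>" "deg_ge (M + N) b"
  consider "y \<odot> S b \<approx> 0"
    | a where "a \<in> \<Lambda>" "src' a = src' b" "\<forall>i<k. deg' b i \<le> deg' a i + N" "y \<odot> S b \<approx> S a"
    using assms(4) b(1) deg_ge_add(2)[OF b(2)] unfolding shifts_def by blast
  then show "x \<odot> y \<odot> S b \<approx> 0 \<or>
     (\<exists>a\<in>\<Lambda>. src' a = src' b \<and> (\<forall>i<k. deg' b i \<le> deg' a i + (M + N)) \<and> x \<odot> y \<odot> S b \<approx> S a)"
  proof cases
    case 1
    then have "x \<odot> (y \<odot> S b) \<approx> x \<odot> 0" using assms(1) by (rule cong_mult_left)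
    then show ?thesis by (simp add: fa_mult_assoc)
  next
    case 2
    have xa: "x \<odot> (y \<odot> S b) \<approx> x \<odot> S a" using 2(4) assms(1) by (rule cong_mult_left)
    \<comment> \<open>At most \<open>N\<close> was lost in passing from \<open>b\<close> to
      \<open>a\<close>, so \<open>a\<close> is still long enough for \<open>x\<close>.\<close>
    have "deg_ge M a"
      unfolding deg_ge_def
    proof (intro allI impI)
      fix i assume "i < k"
      then have "M + N \<le> deg' b i" "deg' b i \<le> deg' a i + N"
        using b(2) 2(3) unfolding deg_ge_def by auto
      then show "M \<le> deg' a i" by linarith
    qed
    then consider "x \<odot> S a \<approx> 0"
      | c where "c \<in> \<Lambda>" "src' c = src' a" "\<forall>i<k. deg' a i \<le> deg' c i + M" "x \<odot> S a \<approx> S c"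
      using assms(3) 2(1) unfolding shifts_def by blast
    then show ?thesis
    proof cases
      case 1
      then show ?thesis using cong_trans[OF xa 1] by (simp add: fa_mult_assoc)
    next
      case c: 2
      have "\<forall>i<k. deg' b i \<le> deg' c i + (M + N)"
      proof (intro allI impI)
        fix i assume "i < k"
        then have "deg' b i \<le> deg' a i + N" "deg' a i \<le> deg' c i + M"
          using 2(3) c(3) by auto
        then show "deg' b i \<le> deg' c i + (M + N)" by linarith
      qed
      then show ?thesis
        using cong_trans[OF xa c(4)] c(1,2) 2(2) by (auto simp: fa_mult_assoc)
    qed
  qed
qed

lemma valid_genE:
  assumes "valid_gen G g"
  obtains l where "l \<in> \<Lambda>" "(fa_gen g :: ('p, 'r::comm_ring_1) fa) = S l \<or> (fa_gen g :: ('p, 'r) fa) = T l"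
proof (cases g)
  case (GP v)
  then show ?thesis using assms that[of v] by (simp add: valid_gen_def sg_def)
next
  case (GS l)
  then have "l \<in> \<Lambda>" "l \<notin> V" using assms deg_vert by (auto simp: valid_gen_def)
  then show ?thesis using that[of l] GS by (simp add: sg_def)
next
  case (GSs l)
  then have "l \<in> \<Lambda>" "l \<notin> V" using assms deg_vert by (auto simp: valid_gen_def)
  then show ?thesis using that[of l] GSs by (simp add: ss_def)
qed

lemma word_induct [consumes 2, case_names gen Cons]:
  assumes "w \<noteq> []" "\<forall>g\<in>set w. valid_gen G g"
    and gen: "\<And>g. valid_gen G g \<Longrightarrow> P (fa_gen g :: ('p, 'r::comm_ring_1) fa)"
    and Cons: "\<And>g x. valid_gen G g \<Longrightarrow> x \<in> C \<Longrightarrow> P x \<Longrightarrow> P (fa_gen g \<odot> x)"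
  shows "P (word w)"
  using assms(1,2)
proof (induction w rule: list_nonempty_induct)
  case (single g)
  then show ?case using gen[of g] by (simp add: fa_gen_eq_word)
next
  case (cons g w)
  then have w: "word w \<in> C" "P (word w)" by simp_all
  have "word (g # w) = fa_gen g \<odot> (word w :: ('p, 'r) fa)"
    using word_append[of "[g]" w] cons.hyps by (simp add: fa_gen_eq_word)
  then show ?case
    using Cons[OF _ w, of g] cons.prems by simp
qed

lemma shifts_gen: "valid_gen G g \<Longrightarrow> \<exists>N. shifts N (fa_gen g :: ('p, 'r::comm_ring_1) fa)"
  by (erule valid_genE[where ?'r = 'r]) (auto intro!: exI shifts_S shifts_T)

lemma carrier_gen: "valid_gen G g \<Longrightarrow> fa_gen g \<in> C"
  by (simp add: fa_gen_eq_word)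

lemma shifts_word:
  assumes "w \<noteq> []" "\<forall>g\<in>set w. valid_gen G g"
  shows "\<exists>N. shifts N (word w :: ('p, 'r::comm_ring_1) fa)"
  using assms
proof (induction rule: word_induct)
  case (gen g)
  then show ?case by (rule shifts_gen)
next
  case (Cons g x)
  then show ?case
    using shifts_mult[OF carrier_gen] shifts_gen by blast
qed

text \<open>Indexing by a set of paths keeps the generators distinct. The common source
  \<open>v\<close> is recorded so that all terms can later be multiplied on the right by the same
  \<open>S t\<close>.\<close>

definition spanned :: "'p \<Rightarrow> ('p, 'r::comm_ring_1) fa \<Rightarrow> bool" where
  "spanned v x \<longleftrightarrow> (\<exists>F c. finite F \<and> F \<subseteq> {a \<in> \<Lambda>. src' a = v} \<and> x \<approx> (\<Sum>a\<in>F. fa_smult (c a) (S a)))"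

lemma spanned_zero: "x \<approx> 0 \<Longrightarrow> spanned v x"
  unfolding spanned_def by (intro exI[of _ "{}"]) simp

lemma spanned_S: "a \<in> \<Lambda> \<Longrightarrow> x \<approx> S a \<Longrightarrow> spanned (src' a) (fa_smult c x)"
  unfolding spanned_def
  by (intro exI[of _ "{a}"] exI[of _ "\<lambda>_. c"]) (simp add: cong_smult)

lemma spanned_add:
  assumes "spanned v x" "spanned v y"
  shows "spanned v (x + y)"
proof -
  obtain F c where F: "finite F" "F \<subseteq> {a \<in> \<Lambda>. src' a = v}" "x \<approx> (\<Sum>a\<in>F. fa_smult (c a) (S a))"
    using assms(1) unfolding spanned_def by blast
  obtain F' c' where F': "finite F'" "F' \<subseteq> {a \<in> \<Lambda>. src' a = v}" "y \<approx> (\<Sum>a\<in>F'. fa_smult (c' a) (S a))"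
    using assms(2) unfolding spanned_def by blast
  \<comment> \<open>Coefficients are extended by zero to the union, where paths common to
    \<open>F\<close> and \<open>F'\<close> are collected into one term.\<close>
  let ?c = "\<lambda>a. (if a \<in> F then c a else 0)" and ?c' = "\<lambda>a. (if a \<in> F' then c' a else 0)"
  have "(\<Sum>a\<in>F. fa_smult (c a) (S a)) = (\<Sum>a\<in>F \<union> F'. fa_smult (?c a) (S a))"
    "(\<Sum>a\<in>F'. fa_smult (c' a) (S a)) = (\<Sum>a\<in>F \<union> F'. fa_smult (?c' a) (S a))"
    using F(1) F'(1) by (intro sum.mono_neutral_cong_left; simp)+
  then have "x + y \<approx> (\<Sum>a\<in>F \<union> F'. fa_smult (?c a + ?c' a) (S a))"
    using cong_add[OF F(3) F'(3)] by (simp only: fa_smult_add_left sum.distrib)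
  then show ?thesis
    unfolding spanned_def using F F' by (intro exI[of _ "F \<union> F'"] exI[of _ "\<lambda>a. ?c a + ?c' a"]) simp
qed

lemma mult_S_spanned:
  fixes x :: "('p, 'r::comm_ring_1) fa"
  assumes "x \<in> C"
  shows "\<exists>N. \<forall>b\<in>\<Lambda>. deg_ge N b \<longrightarrow> spanned (src' b) (x \<odot> S b)"
  using assms
proof (induction rule: carrier_induct)
  case zero
  then show ?case by (simp add: spanned_zero)
next
  case (add x c w)
  obtain N where N: "\<forall>b\<in>\<Lambda>. deg_ge N b \<longrightarrow> spanned (src' b) (x \<odot> S b)"
    using add.IH by blast
  obtain M where M: "shifts M (word w :: ('p, 'r) fa)"
    using shifts_word[OF add.hyps(2,3)] by blast
  have "spanned (src' b) ((x + fa_smult c (word w)) \<odot> S b)" if b: "b \<in> \<Lambda>" "deg_ge (M + N) b" for b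
  proof -
    have "spanned (src' b) (fa_smult c ((word w :: ('p, 'r) fa) \<odot> S b))"
      using M b(1) deg_ge_add(1)[OF b(2)] spanned_S spanned_zero cong_smult[of _ 0 c]
      unfolding shifts_def by (metis fa_smult_simps(2))
    moreover have "spanned (src' b) (x \<odot> S b)"
      using N b(1) deg_ge_add(2)[OF b(2)] by blast
    ultimately show ?thesis
      unfolding fa_mult_add_left fa_mult_smult_left by (intro spanned_add)
  qed
  then show ?case by blast
qed

text \<open>The last letter decides: the projection at \<open>s(l)\<close> fixes s_l from the right,
  and the projection at \<open>r(l)\<close> fixes s_l*.\<close>

lemma word_right_unit:
  assumes "w \<noteq> []" "\<forall>g\<in>set w. valid_gen G g"
  shows "\<exists>u\<in>V. (word w :: ('p, 'r::comm_ring_1) fa) \<odot> S u \<approx> word w"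
  using assms
proof (induction rule: word_induct)
  case (gen g)
  then obtain l where "l \<in> \<Lambda>" "(fa_gen g :: ('p, 'r) fa) = S l \<or> (fa_gen g :: ('p, 'r) fa) = T l"
    by (rule valid_genE)
  then show ?case
    by (metis S_src T_rng src_vert rng_vert)
next
  case (Cons g x)
  then obtain u where u: "u \<in> V" "x \<odot> S u \<approx> x" by blast
  then have "fa_gen g \<odot> x \<odot> S u \<approx> fa_gen g \<odot> x"
    unfolding fa_mult_assoc using Cons.hyps by (intro cong_mult_left carrier_gen)
  then show ?case using u(1) by blast
qed

lemma mult_vertex_sum:
  assumes "x \<in> C" "u \<in> W" "W \<subseteq> V" "finite W" "x \<odot> S u \<approx> x"
  shows "x \<odot> (\<Sum>v\<in>W. S v) \<approx> x"
proof -
  have "x \<odot> (\<Sum>v\<in>W. S v) \<approx> x \<odot> S u \<odot> (\<Sum>v\<in>W. S v)"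
    using assms by (intro cong_mult_right cong_sym[OF assms(5)] carrier_sum) auto
  also have "\<dots> = x \<odot> (\<Sum>v\<in>W. S u \<odot> S v)"
    by (simp add: fa_mult_assoc fa_mult_sum_right)
  also have "\<dots> \<approx> x \<odot> (\<Sum>v\<in>W. if u = v then S u else 0)"
    using assms by (intro cong_mult_left cong_sum S_vert_mult) auto
  also have "\<dots> = x \<odot> S u"
    using assms by simp
  also have "\<dots> \<approx> x" by (rule assms(5))
  finally show ?thesis .
qed

text \<open>Finite sums of vertex projections serve as local right units. Allowing every larger
  finite \<open>W\<close> lets the two summands in the induction share one set.\<close>

lemma carrier_right_unit:
  fixes x :: "('p, 'r::comm_ring_1) fa"
  assumes "x \<in> C"
  shows "\<exists>W0. finite W0 \<and> W0 \<subseteq> V \<and>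
    (\<forall>W. finite W \<longrightarrow> W0 \<subseteq> W \<longrightarrow> W \<subseteq> V \<longrightarrow> x \<odot> (\<Sum>v\<in>W. S v) \<approx> x)"
  using assms
proof (induction rule: carrier_induct)
  case zero
  then show ?case by (intro exI[of _ "{}"]) simp
next
  case (add x c w)
  obtain W0 where W0: "finite W0" "W0 \<subseteq> V"
    "\<And>W. finite W \<Longrightarrow> W0 \<subseteq> W \<Longrightarrow> W \<subseteq> V \<Longrightarrow> x \<odot> (\<Sum>v\<in>W. S v) \<approx> x"
    using add.IH by blast
  obtain u where u: "u \<in> V" "(word w :: ('p, 'r) fa) \<odot> S u \<approx> word w"
    using word_right_unit[OF add.hyps(2,3)] by blast
  have "(x + fa_smult c (word w)) \<odot> (\<Sum>v\<in>W. S v) \<approx> x + fa_smult c (word w)"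
    if W: "finite W" "insert u W0 \<subseteq> W" "W \<subseteq> V" for W
    unfolding fa_mult_add_left fa_mult_smult_left
    using W u add.hyps by (intro cong_add[OF W0(3)] cong_smult mult_vertex_sum[of _ u]) auto
  then show ?case
    using W0(1,2) u(1) by (intro exI[of _ "insert u W0"]) simp
qed

text \<open>By (KP4) in a large degree, \<open>x S v\<close> is a sum of terms
  \<open>x S l T l\<close>, each in the ideal; a local right unit then recovers
  \<open>x\<close>.\<close>

lemma ideal_if_mult_S:
  fixes x :: "('p, 'r::comm_ring_1) fa"
  assumes "x \<in> C" "\<And>b. b \<in> \<Lambda> \<Longrightarrow> deg_ge N b \<Longrightarrow> x \<odot> S b \<in> I"
  shows "x \<in> I"
proof -
  have v: "x \<odot> S v \<in> I" if "v \<in> V" for v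
  proof -
    let ?n = "\<lambda>i. if i < k then N else 0"
    have n: "in_Nk k ?n" by (simp add: in_Nk_def)
    have "x \<odot> S v \<approx> x \<odot> (\<Sum>l\<in>vLn G v ?n. S l \<odot> T l)"
      by (rule cong_mult_left[OF S_vert_expand[OF that n] assms(1)])
    also have "\<dots> = (\<Sum>l\<in>vLn G v ?n. x \<odot> S l \<odot> T l)"
      by (simp add: fa_mult_sum_right fa_mult_assoc)
    finally have "x \<odot> S v \<in> I \<longleftrightarrow> (\<Sum>l\<in>vLn G v ?n. x \<odot> S l \<odot> T l) \<in> I"
      by (rule cong_ideal_iff)
    moreover have "x \<odot> S l \<odot> T l \<in> I" if "l \<in> vLn G v ?n" for l
    proof -
      have "l \<in> \<Lambda>" "deg_ge N l" using vLnD[OF that] by (simp_all add: deg_ge_def)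
      then show ?thesis using ideal_mult_right[OF assms(2)] by simp
    qed
    then have "(\<Sum>l\<in>vLn G v ?n. x \<odot> S l \<odot> T l) \<in> I" by (rule ideal_sum)
    ultimately show ?thesis by simp
  qed
  obtain W where W: "finite W" "W \<subseteq> V" "x \<odot> (\<Sum>v\<in>W. S v) \<approx> x"
    using carrier_right_unit[OF assms(1)] by blast
  have "x \<odot> (\<Sum>v\<in>W. S v) \<in> I"
    unfolding fa_mult_sum_right using v W(2) by (intro ideal_sum) blast
  then show ?thesis using cong_ideal_iff[OF W(3)] by simp
qed

section \<open>The action on functions of paths\<close>

definition tail :: "'p \<Rightarrow> 'p \<Rightarrow> 'p" where
  "tail l m = (THE n. n \<in> \<Lambda> \<and> src' l = rng' n \<and> m = l \<cdot> n)"

text \<open>On indicator functions of paths, \<open>actS l\<close> prefixes \<open>l\<close> and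
  \<open>actT l\<close> removes the prefix \<open>l\<close>, giving zero where this is
  impossible.\<close>

definition actS :: "'p \<Rightarrow> ('p \<Rightarrow> 'r::comm_ring_1) \<Rightarrow> 'p \<Rightarrow> 'r" where
  "actS l f m = (if m \<in> \<Lambda> \<and> extends m l then f (tail l m) else 0)"

definition actT :: "'p \<Rightarrow> ('p \<Rightarrow> 'r::comm_ring_1) \<Rightarrow> 'p \<Rightarrow> 'r" where
  "actT l f m = (if m \<in> \<Lambda> \<and> src' l = rng' m then f (l \<cdot> m) else 0)"

definition act_gen :: "'p kpgen \<Rightarrow> ('p \<Rightarrow> 'r::comm_ring_1) \<Rightarrow> 'p \<Rightarrow> 'r" where
  "act_gen g = (case g of GP v \<Rightarrow> actS v | GS l \<Rightarrow> actS l | GSs l \<Rightarrow> actT l)"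

definition act :: "('p, 'r::comm_ring_1) fa \<Rightarrow> ('p \<Rightarrow> 'r) \<Rightarrow> 'p \<Rightarrow> 'r" where
  "act x f m = (\<Sum>w | x w \<noteq> 0. x w * foldr act_gen w f m)"

lemma tail_cmp:
  assumes "l \<in> \<Lambda>" "n \<in> \<Lambda>" "src' l = rng' n"
  shows "tail l (l \<cdot> n) = n"
  unfolding tail_def
proof (rule the_equality)
  fix p assume p: "p \<in> \<Lambda> \<and> src' l = rng' p \<and> l \<cdot> n = l \<cdot> p"
  then show "p = n" using cmp_left_cancel[of l n p] assms by simp
qed (use assms in blast)

lemma actS_cmp: "l \<in> \<Lambda> \<Longrightarrow> n \<in> \<Lambda> \<Longrightarrow> src' l = rng' n \<Longrightarrow> actS l f (l \<cdot> n) = f n"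
  unfolding actS_def by (simp add: tail_cmp extends_cmp)

lemma actS_not_extends: "\<not> extends m l \<Longrightarrow> actS l f m = 0"
  unfolding actS_def by simp

text \<open>A vertex generator stands for both \<open>S v\<close> and \<open>T v\<close>, so its two
  possible actions must agree.\<close>

lemma actS_vert: "v \<in> V \<Longrightarrow> actS v = (actT v :: ('p \<Rightarrow> 'r::comm_ring_1) \<Rightarrow> 'p \<Rightarrow> 'r)"
proof (intro ext)
  fix f :: "'p \<Rightarrow> 'r" and m assume v: "v \<in> V"
  show "actS v f m = actT v f m"
  proof (cases "m \<in> \<Lambda> \<and> rng' m = v")
    case True
    then have "v \<cdot> m = m" using cmp_rng by blast
    then show ?thesis using actS_cmp[of v m f] v True by (simp add: actT_def)
  next
    case False
    then have "\<not> (m \<in> \<Lambda> \<and> extends m v)"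
      using v unfolding extends_def by auto
    then have "actS v f m = 0" unfolding actS_def by (simp only: if_False)
    then show ?thesis using False v by (auto simp: actT_def)
  qed
qed

lemma act_gen_add: "act_gen g (f + h) = act_gen g f + act_gen g h"
  by (cases g) (auto simp: act_gen_def actS_def actT_def fun_apply intro!: ext)

lemma act_gen_scale: "act_gen g (\<lambda>m. c * f m) = (\<lambda>m. c * act_gen g f m)"
  by (cases g) (auto simp: act_gen_def actS_def actT_def intro!: ext)

lemma foldr_act_add: "foldr act_gen w (f + h) = foldr act_gen w f + foldr act_gen w h"
  by (induction w) (simp_all add: act_gen_add)

lemma foldr_act_scale: "foldr act_gen w (\<lambda>m. c * f m) = (\<lambda>m. c * foldr act_gen w f m)"
  by (induction w) (simp_all add: act_gen_scale)

lemma foldr_act_zero: "foldr act_gen w 0 = 0"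
  using foldr_act_scale[of w 0 0] by (simp add: zero_fun_def)

lemma act_superset:
  "finite A \<Longrightarrow> {w. x w \<noteq> 0} \<subseteq> A \<Longrightarrow> act x f m = (\<Sum>w\<in>A. x w * foldr act_gen w f m)"
  unfolding act_def by (rule sum.mono_neutral_left) auto

lemma carrier_finite: "x \<in> C \<Longrightarrow> finite {w. x w \<noteq> 0}"
  by (simp add: fa_carrier_def)

lemma act_add: "x \<in> C \<Longrightarrow> y \<in> C \<Longrightarrow> act (x + y) f = act x f + act y f"
proof
  fix m assume xy: "x \<in> C" "y \<in> C"
  let ?A = "{w. x w \<noteq> 0} \<union> {w. y w \<noteq> 0}"
  have "finite ?A" using xy carrier_finite by blast
  moreover have "{w. (x + y) w \<noteq> 0} \<subseteq> ?A" by (auto simp: fun_apply)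
  ultimately show "act (x + y) f m = (act x f + act y f) m"
    using act_superset[of ?A "x + y" f m] act_superset[of ?A x f m] act_superset[of ?A y f m]
    by (simp add: fun_apply distrib_right sum.distrib)
qed

lemma act_smult: "x \<in> C \<Longrightarrow> act (fa_smult c x) f = (\<lambda>m. c * act x f m)"
proof
  fix m assume x: "x \<in> C"
  have "{w. fa_smult c x w \<noteq> 0} \<subseteq> {w. x w \<noteq> 0}" by (auto simp: fa_smult_def)
  then show "act (fa_smult c x) f m = c * act x f m"
    using act_superset[OF carrier_finite[OF x], of "fa_smult c x"]
    by (simp add: act_def fa_smult_def sum_distrib_left mult.assoc)
qed

lemma act_zero: "act 0 f = 0"
  by (auto simp: act_def fun_apply intro!: ext)

lemma act_diff:
  assumes "x \<in> C" "y \<in> C" shows "act (x - y) f = act x f - act y f"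
  using act_add[OF assms(1) carrier_smult[OF assms(2), of "-1"], of f] act_smult[OF assms(2), of "-1" f]
  by (auto simp: fa_smult_minus_one fun_apply intro!: ext)

lemma act_sum: "(\<And>i. i \<in> A \<Longrightarrow> F i \<in> C) \<Longrightarrow> act (sum F A) f m = (\<Sum>i\<in>A. act (F i) f m)"
  by (induction A rule: infinite_finite_induct) (simp_all add: act_zero act_add fun_apply)

lemma act_word: "act (word w) f = foldr act_gen w f"
proof
  fix m
  show "act (word w) f m = foldr act_gen w f m"
    using act_superset[of "{w}" "word w" f m] by (simp add: word_def)
qed

lemma act_word_mult:
  fixes y :: "('p, 'r::comm_ring_1) fa"
  assumes "y \<in> C" "w \<noteq> []" "\<forall>g\<in>set w. valid_gen G g"
  shows "act (word w \<odot> y) f = foldr act_gen w (act y f)"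
  using assms(1)
proof (induction rule: carrier_induct)
  case zero
  then show ?case by (simp add: act_zero foldr_act_zero)
next
  case (add y c u)
  have wu: "word w \<odot> (word u :: ('p, 'r) fa) \<in> C" "word w \<odot> y \<in> C" using assms add.hyps by simp_all
  have "act (word w \<odot> (y + fa_smult c (word u))) f
      = act (word w \<odot> y) f + (\<lambda>m. c * act (word w \<odot> word u) f m)"
    using wu by (simp add: fa_mult_add_right fa_mult_smult_right act_add act_smult)
  also have "word w \<odot> word u = (word (w @ u) :: ('p, 'r) fa)"
    using assms add.hyps by (simp add: word_append)
  also have "(\<lambda>m. c * act (word (w @ u)) f m) = foldr act_gen w (\<lambda>m. c * act (word u) f m)"
    by (simp add: act_word foldr_act_scale)
  also have "act (word w \<odot> y) f = foldr act_gen w (act y f)" by (rule add.IH)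
  finally show ?case
    using add.hyps by (simp add: foldr_act_add[symmetric] act_add act_smult)
qed

lemma act_mult:
  assumes "x \<in> C" "y \<in> C"
  shows "act (x \<odot> y) f = act x (act y f)"
  using assms(1)
proof (induction rule: carrier_induct)
  case zero
  then show ?case by (simp add: act_zero)
next
  case (add x c w)
  have "word w \<odot> y \<in> C" "x \<odot> y \<in> C" using assms add.hyps by simp_all
  then have "act ((x + fa_smult c (word w)) \<odot> y) f
      = act (x \<odot> y) f + (\<lambda>m. c * act (word w \<odot> y) f m)"
    by (simp add: fa_mult_add_left fa_mult_smult_left act_add act_smult)
  then show ?case
    using add by (simp add: act_add act_smult act_word_mult[OF assms(2)] act_word)
qed

lemma act_S: "l \<in> \<Lambda> \<Longrightarrow> act (S l) = actS l"
  by (auto simp: sg_def fa_gen_eq_word act_word act_gen_def intro!: ext)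

lemma act_T: "l \<in> \<Lambda> \<Longrightarrow> act (T l) = actT l"
  by (auto simp: ss_def fa_gen_eq_word act_word act_gen_def actS_vert intro!: ext)

text \<open>This lemma, \<open>actT_actT\<close> and \<open>actT_actS\<close> show that (KP1), (KP2)
  and (KP3) hold exactly on functions of paths.\<close>

lemma actS_actS:
  assumes l: "l \<in> \<Lambda>" "n \<in> \<Lambda>" "src' l = rng' n"
  shows "actS l (actS n f) = actS (l \<cdot> n) f"
proof
  fix m
  show "actS l (actS n f) m = actS (l \<cdot> n) f m"
  proof (cases "m \<in> \<Lambda> \<and> extends m l")
    case True
    then obtain p where p: "p \<in> \<Lambda>" "src' l = rng' p" "m = l \<cdot> p"
      unfolding extends_def by blast
    have lhs: "actS l (actS n f) m = actS n f p"
      unfolding p(3) by (rule actS_cmp[OF l(1) p(1,2)])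
    show ?thesis
    proof (cases "extends p n")
      case True
      then obtain q where q: "q \<in> \<Lambda>" "src' n = rng' q" "p = n \<cdot> q"
        unfolding extends_def by blast
      have "m = l \<cdot> n \<cdot> q" unfolding p(3) q(3) using l q(1,2) by (simp add: cmp_assoc)
      moreover have "actS n f p = f q" unfolding q(3) by (rule actS_cmp[OF l(2) q(1,2)])
      moreover have "actS (l \<cdot> n) f (l \<cdot> n \<cdot> q) = f q"
        using l q(1,2) by (intro actS_cmp) simp_all
      ultimately show ?thesis using lhs by simp
    next
      case False
      have "\<not> extends m (l \<cdot> n)"
      proof
        assume "extends m (l \<cdot> n)"
        then obtain q where q: "q \<in> \<Lambda>" "src' n = rng' q" "m = l \<cdot> n \<cdot> q"
          unfolding extends_def using l by auto
        have "l \<cdot> p = l \<cdot> (n \<cdot> q)"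
          unfolding p(3)[symmetric] unfolding q(3) using l q(1,2) by (simp add: cmp_assoc)
        then have "p = n \<cdot> q"
          by (rule cmp_left_cancel[THEN iffD1, rotated -1]) (use l p(1,2) q(1,2) in simp_all)
        then show False using False q(1,2) unfolding extends_def by blast
      qed
      then show ?thesis using lhs False by (simp add: actS_not_extends)
    qed
  next
    case False
    moreover have "extends m l" if e: "extends m (l \<cdot> n)"
    proof -
      obtain q where q: "q \<in> \<Lambda>" "src' n = rng' q" "m = l \<cdot> n \<cdot> q"
        using e unfolding extends_def using l by auto
      have "m = l \<cdot> (n \<cdot> q)" unfolding q(3) using l q(1,2) by (simp add: cmp_assoc)
      then show ?thesis using extends_cmp[OF l(1), of "n \<cdot> q"] l q(1,2) by simp
    qed
    ultimately show ?thesis unfolding actS_def by auto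
  qed
qed

lemma actT_actT:
  assumes l: "l \<in> \<Lambda>" "n \<in> \<Lambda>" "src' l = rng' n"
  shows "actT n (actT l f) = actT (l \<cdot> n) f"
proof
  fix m
  show "actT n (actT l f) m = actT (l \<cdot> n) f m"
    unfolding actT_def using l by (simp add: cmp_assoc)
qed

lemma actT_actS:
  assumes l: "l \<in> \<Lambda>" "n \<in> \<Lambda>" "deg' l = deg' n"
  shows "actT l (actS n f) = (if l = n then actS (src' l) f else 0)"
proof
  fix m
  show "actT l (actS n f) m = (if l = n then actS (src' l) f else 0) m"
  proof (cases "m \<in> \<Lambda> \<and> src' l = rng' m")
    case True
    then have m: "m \<in> \<Lambda>" "src' l = rng' m" by simp_all
    have lhs: "actT l (actS n f) m = actS n f (l \<cdot> m)" unfolding actT_def using True by simp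
    show ?thesis
    proof (cases "l = n")
      case True
      then show ?thesis
        using lhs actS_cmp[OF l(1) m, of f] m l(1) by (simp add: actS_vert actT_def)
    next
      case False
      have "\<not> extends (l \<cdot> m) n"
      proof
        assume "extends (l \<cdot> m) n"
        then obtain q where "q \<in> \<Lambda>" "src' n = rng' q" "l \<cdot> m = n \<cdot> q"
          unfolding extends_def by blast
        then show False using cmp_cancel[OF l(1) m(1) l(2) _ m(2) _ _ l(3)] False by blast
      qed
      then show ?thesis using lhs False by (simp add: actS_not_extends fun_apply)
    qed
  next
    case False
    then have "actT l (actS n f) m = 0" unfolding actT_def by (simp only: if_False)
    moreover have "actS (src' l) f m = 0"
      unfolding actS_vert[OF src_vert[OF l(1)]] actT_def src_of_vert[OF src_vert[OF l(1)]]
      using False by (simp only: if_False)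
    ultimately show ?thesis by (cases "l = n") (simp_all add: fun_apply)
  qed
qed

section \<open>Functions vanishing in large degree, and the Kumjian-Pask relations modulo
  them\<close>

definition vanishes :: "nat \<Rightarrow> ('p \<Rightarrow> 'r::comm_ring_1) \<Rightarrow> bool" where
  "vanishes N f \<longleftrightarrow> (\<forall>m\<in>\<Lambda>. deg_ge N m \<longrightarrow> f m = 0)"

lemma vanishes_zero: "vanishes N 0"
  by (simp add: vanishes_def fun_apply)

lemma vanishes_add: "vanishes N f \<Longrightarrow> vanishes M h \<Longrightarrow> vanishes (N + M) (f + h)"
  unfolding vanishes_def fun_apply by (metis add_0 deg_ge_add)

lemma vanishes_scale: "vanishes N f \<Longrightarrow> vanishes N (\<lambda>m. c * f m)"
  unfolding vanishes_def by simp

text \<open>Prefixing \<open>l\<close> raises the bound by at most the total degree of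
  \<open>l\<close>. Removing a prefix evaluates \<open>f\<close> at \<open>l m\<close>, which is at
  least as long as \<open>m\<close>, so the bound is kept. That \<open>M\<close> does not depend on
  \<open>N\<close> or \<open>f\<close> lets the bounds add up along a word.\<close>

lemma vanishes_act_gen:
  assumes "valid_gen G g"
  shows "\<exists>M. \<forall>N f. vanishes N (f :: 'p \<Rightarrow> 'r::comm_ring_1) \<longrightarrow> vanishes (M + N) (act_gen g f)"
proof -
  have S: "vanishes (total_deg l + N) (actS l f)" if l: "l \<in> \<Lambda>" "vanishes N f" for l N and f :: "'p \<Rightarrow> 'r"
    unfolding vanishes_def
  proof (intro ballI impI)
    fix m assume m: "m \<in> \<Lambda>" "deg_ge (total_deg l + N) m"
    show "actS l f m = 0"
    proof (cases "extends m l")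
      case True
      then obtain p where p: "p \<in> \<Lambda>" "src' l = rng' p" "m = l \<cdot> p"
        unfolding extends_def by blast
      have "N \<le> deg' p i" if "i < k" for i
      proof -
        have "total_deg l + N \<le> deg' l i + deg' p i"
          using m(2) that l(1) p(1,2) unfolding deg_ge_def p(3) by (simp add: addv_def)
        then show ?thesis using deg_le_total_deg[OF that, of l] by simp
      qed
      then have "f p = 0" using l(2) p(1) unfolding vanishes_def deg_ge_def by blast
      then show ?thesis unfolding p(3) by (simp add: actS_cmp[OF l(1) p(1,2)])
    qed (rule actS_not_extends)
  qed
  have T: "vanishes (0 + N) (actT l f)" if l: "l \<in> \<Lambda>" "vanishes N f" for l N and f :: "'p \<Rightarrow> 'r"
    unfolding vanishes_def
  proof (intro ballI impI)
    fix m assume m: "m \<in> \<Lambda>" "deg_ge (0 + N) m"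
    show "actT l f m = 0"
    proof (cases "src' l = rng' m")
      case True
      then have "deg_ge N (l \<cdot> m)" "l \<cdot> m \<in> \<Lambda>"
        using m l(1) unfolding deg_ge_def by (auto simp: addv_def trans_le_add2)
      then show ?thesis using l(2) unfolding vanishes_def actT_def by simp
    qed (simp add: actT_def)
  qed
  show ?thesis
  proof (cases g)
    case (GP v)
    then show ?thesis using S[of v] assms by (auto simp: act_gen_def valid_gen_def)
  next
    case (GS l)
    then show ?thesis using S[of l] assms by (auto simp: act_gen_def valid_gen_def)
  next
    case (GSs l)
    then show ?thesis using T[of l] assms
      by (intro exI[of _ 0]) (simp add: act_gen_def valid_gen_def)
  qed
qed

lemma vanishes_foldr:
  assumes "\<forall>g\<in>set w. valid_gen G g"
  shows "\<exists>M. \<forall>N f. vanishes N (f :: 'p \<Rightarrow> 'r::comm_ring_1) \<longrightarrow> vanishes (M + N) (foldr act_gen w f)"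
  using assms
proof (induction w)
  case Nil
  show ?case by (intro exI[of _ 0]) simp
next
  case (Cons g w)
  obtain M where M: "\<And>N f. vanishes N (f :: 'p \<Rightarrow> 'r) \<Longrightarrow> vanishes (M + N) (foldr act_gen w f)"
    using Cons by auto
  obtain M' where M': "\<And>N f. vanishes N (f :: 'p \<Rightarrow> 'r) \<Longrightarrow> vanishes (M' + N) (act_gen g f)"
    using vanishes_act_gen[of g] Cons.prems by auto
  have "vanishes (M' + M + N) (foldr act_gen (g # w) f)" if "vanishes N f" for N and f :: "'p \<Rightarrow> 'r"
    using M'[OF M[OF that]] by (simp add: add.assoc)
  then show ?case by blast
qed

lemma vanishes_act:
  fixes x :: "('p, 'r::comm_ring_1) fa"
  assumes "x \<in> C"
  shows "\<exists>M. \<forall>N f. vanishes N f \<longrightarrow> vanishes (M + N) (act x f)"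
  using assms
proof (induction rule: carrier_induct)
  case zero
  then show ?case by (simp add: act_zero vanishes_zero)
next
  case (add x c w)
  obtain M where M: "\<And>N f. vanishes N f \<Longrightarrow> vanishes (M + N) (act x f)"
    using add.IH by blast
  obtain M' where M': "\<And>N f. vanishes N (f :: 'p \<Rightarrow> 'r) \<Longrightarrow> vanishes (M' + N) (foldr act_gen w f)"
    using vanishes_foldr[OF add.hyps(3)] by blast
  have "vanishes (M + M' + N) (act (x + fa_smult c (word w)) f)" if f: "vanishes N f" for N f
  proof -
    have "vanishes (M' + N) (act (fa_smult c (word w)) f)"
      using vanishes_scale[OF M'[OF f]] add.hyps by (simp add: act_smult act_word)
    moreover have "act (x + fa_smult c (word w)) f = act x f + act (fa_smult c (word w)) f"
      using add.hyps by (simp add: act_add)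
    moreover have "deg_ge (M + N) m" "deg_ge (M' + N) m" if "deg_ge (M + M' + N) m" for m
      using that unfolding deg_ge_def by force+
    ultimately show ?thesis
      using M[OF f] unfolding vanishes_def by (simp add: fun_apply)
  qed
  then show ?case by blast
qed

lemma actS_actT:
  assumes "l \<in> \<Lambda>" "m \<in> \<Lambda>"
  shows "actS l (actT l f) m = (if extends m l then f m else 0)"
proof (cases "extends m l")
  case True
  then obtain p where p: "p \<in> \<Lambda>" "src' l = rng' p" "m = l \<cdot> p"
    unfolding extends_def by blast
  then show ?thesis using True by (simp add: actS_cmp[OF assms(1) p(1,2)] actT_def)
qed (simp add: actS_not_extends)

text \<open>A path \<open>m\<close> with \<open>n \<le> d(m)\<close> has exactly one initial segment
  of degree \<open>n\<close>, so at most one summand is nonzero. If \<open>n \<le> d(m)\<close>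
  fails, no \<open>l\<close> is a prefix of \<open>m\<close> and the sum is zero, so (KP4) is
  recovered only in large degree.\<close>

lemma sum_actS_actT:
  assumes "v \<in> V" "in_Nk k n" "m \<in> \<Lambda>" "n \<le> deg' m"
  shows "(\<Sum>l\<in>vLn G v n. actS l (actT l f) m) = actS v f m"
proof -
  obtain a b where f: "a \<in> \<Lambda>" "b \<in> \<Lambda>" "src' a = rng' b" "deg' a = n" "m = a \<cdot> b"
    by (rule factorE[OF assms(3,4)])
  have rm: "rng' m = rng' a" unfolding f(5) using f(1-3) by simp
  have "extends m l \<longleftrightarrow> l = a" if "l \<in> vLn G v n" for l
  proof
    assume "extends m l"
    then obtain p where "p \<in> \<Lambda>" "src' l = rng' p" "l \<cdot> p = a \<cdot> b"
      unfolding extends_def f(5) by metis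
    then show "l = a" using cmp_cancel[of l p a b] vLnD[OF that] f(1-4) by simp
  next
    assume "l = a"
    then show "extends m l" unfolding f(5) using f(1-3) extends_cmp by simp
  qed
  then have "(\<Sum>l\<in>vLn G v n. actS l (actT l f) m) = (\<Sum>l\<in>vLn G v n. if l = a then f m else 0)"
    using vLnD assms(3) by (intro sum.cong) (simp_all add: actS_actT)
  also have "\<dots> = (if a \<in> vLn G v n then f m else 0)"
    using assms by (simp add: sum.delta)
  also have "\<dots> = actS v f m"
    using assms f(1,4) rm cmp_rng[OF assms(3)] by (auto simp: actS_vert actT_def vLn_def)
  finally show ?thesis .
qed

lemma vanishes_rel:
  fixes x :: "('p, 'r::comm_ring_1) fa"
  assumes "x \<in> kp_rels G k"
  shows "\<exists>N. \<forall>f. vanishes N (act x f)"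
proof -
  \<comment> \<open>Covers every relation that holds exactly on functions; only (KP4) needs a
    positive bound.\<close>
  have *: "\<exists>N. \<forall>f. vanishes N (act (fa_sub y z) f)"
    if "y \<in> C" "z \<in> C" "\<And>f. act y f = act z f" for y z :: "('p, 'r) fa"
    using that by (auto simp: act_diff vanishes_zero)
  note act_simps = act_mult act_S act_T pv_eq
  show ?thesis
    using assms unfolding kp_rels_def Un_iff mem_Collect_eq
  proof (elim disjE exE conjE)
    fix v w assume x: "x = fa_sub (pv v \<odot> pv w) (if v = w then pv v else fa_zero)" and v: "v \<in> V" "w \<in> V"
    have "actS v (actS w f) = (if v = w then actS v f else 0)" for f :: "'p \<Rightarrow> 'r"
      using actT_actS[of v w f] v by (simp add: actS_vert)
    then show ?thesis unfolding x using v by (intro *) (simp_all add: act_simps act_zero)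
  next
    fix l m assume x: "x = fa_sub (S l \<odot> S m) (S (l \<cdot> m))" and l: "l \<in> \<Lambda>" "m \<in> \<Lambda>" "rng' m = src' l"
    then show ?thesis unfolding x by (intro *) (simp_all add: act_simps actS_actS)
  next
    fix l m assume x: "x = fa_sub (T m \<odot> T l) (T (l \<cdot> m))" and l: "l \<in> \<Lambda>" "m \<in> \<Lambda>" "rng' m = src' l"
    then show ?thesis unfolding x by (intro *) (simp_all add: act_simps actT_actT)
  next
    fix l assume x: "x = fa_sub (pv (rng' l) \<odot> S l) (S l)" and l: "l \<in> \<Lambda>"
    then show ?thesis unfolding x by (intro *) (simp_all add: act_simps actS_actS)
  next
    fix l assume x: "x = fa_sub (S l \<odot> pv (src' l)) (S l)" and l: "l \<in> \<Lambda>"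
    then show ?thesis unfolding x by (intro *) (simp_all add: act_simps actS_actS)
  next
    fix l assume x: "x = fa_sub (pv (src' l) \<odot> T l) (T l)" and l: "l \<in> \<Lambda>"
    then show ?thesis unfolding x by (intro *) (simp_all add: act_simps actS_vert actT_actT)
  next
    fix l assume x: "x = fa_sub (T l \<odot> pv (rng' l)) (T l)" and l: "l \<in> \<Lambda>"
    then show ?thesis unfolding x by (intro *) (simp_all add: act_simps actS_vert actT_actT)
  next
    fix l m assume x: "x = fa_sub (T l \<odot> S m) (if l = m then pv (src' l) else fa_zero)"
      and l: "l \<in> \<Lambda>" "m \<in> \<Lambda>" "deg' l = deg' m"
    then show ?thesis unfolding x by (intro *) (simp_all add: act_simps actT_actS act_zero)
  next
    fix v n assume x: "x = fa_sub (pv v) (fa_sum (vLn G v n) (\<lambda>l. S l \<odot> T l))"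
      and v: "v \<in> V" "in_Nk k n"
    let ?N = "\<Sum>i<k. n i"
    have C: "(S l :: ('p, 'r) fa) \<odot> T l \<in> C" if "l \<in> vLn G v n" for l
      using vLnD[OF that] by simp
    have "vanishes ?N (act x f)" for f
      unfolding vanishes_def
    proof (intro ballI impI)
      fix m assume m: "m \<in> \<Lambda>" "deg_ge ?N m"
      have "n i \<le> deg' m i" for i
      proof (cases "i < k")
        case True
        then have "n i \<le> ?N" by (intro member_le_sum) simp_all
        then show ?thesis using m(2) True unfolding deg_ge_def by force
      next
        case False
        then show ?thesis using v(2) by (simp add: in_Nk_def)
      qed
      then have n: "n \<le> deg' m" by (simp add: le_fun_def)
      have "act x f m = actS v f m - (\<Sum>l\<in>vLn G v n. act (S l \<odot> T l) f m)"
        unfolding x using v C by (simp add: act_diff act_simps fun_apply act_sum)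
      also have "(\<Sum>l\<in>vLn G v n. act (S l \<odot> T l) f m) = (\<Sum>l\<in>vLn G v n. actS l (actT l f) m)"
        by (intro sum.cong) (auto dest!: vLnD simp: act_simps)
      finally show "act x f m = 0"
        using sum_actS_actT[OF v m(1) n, of f] by simp
    qed
    then show ?thesis by blast
  qed
qed

text \<open>On functions modulo those that vanish on all paths of large degree, the action factors through
  the quotient by the ideal: only (KP4) fails, and it fails only on paths of small degree.\<close>

lemma vanishes_ideal: "x \<in> I \<Longrightarrow> \<exists>N. \<forall>f. vanishes N (act x f)"
proof (induction rule: kp_ideal.induct)
  case (rel x)
  then show ?case by (rule vanishes_rel)
next
  case zero
  then show ?case by (simp add: act_zero vanishes_zero)
next
  case (add x y)
  then obtain N M where "\<forall>f. vanishes N (act x f)" "\<forall>f. vanishes M (act y f)" by blast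
  then have "\<forall>f. vanishes (N + M) (act (fa_add x y) f)"
    using add.hyps by (simp add: ideal_carrier act_add vanishes_add)
  then show ?case by blast
next
  case (smult x c)
  then obtain N where "\<forall>f. vanishes N (act x f)" by blast
  then have "\<forall>f. vanishes N (act (fa_smult c x) f)"
    by (simp add: act_smult[OF ideal_carrier[OF smult.hyps]] vanishes_scale)
  then show ?case by blast
next
  case (multl x w)
  then obtain N where "\<forall>f. vanishes N (act x f)" by blast
  moreover obtain M where "\<And>N f. vanishes N f \<Longrightarrow> vanishes (M + N) (act w f)"
    using vanishes_act[OF multl.hyps(2)] by blast
  ultimately have "\<forall>f. vanishes (M + N) (act (w \<odot> x) f)"
    using multl.hyps by (simp add: ideal_carrier act_mult)
  then show ?case by blast
next
  case (multr x w)
  then obtain N where "\<forall>f. vanishes N (act x f)" by blast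
  \<comment> \<open>The bound for \<open>x\<close> is uniform in the function, so it applies to
    \<open>act w f\<close> in place of \<open>f\<close>.\<close>
  then have "\<forall>f. vanishes N (act (x \<odot> w) f)"
    by (simp add: act_mult[OF ideal_carrier[OF multr.hyps(1)] multr.hyps(2)])
  then show ?case by blast
qed

text \<open>The coefficient at \<open>a0\<close> is read off by evaluating, at a path \<open>m\<close> of large degree, the image
  of the indicator function of \<open>m\<close>.\<close>

lemma T_S_sum_not_ideal:
  fixes c :: "'p \<Rightarrow> 'r::comm_ring_1"
  assumes "finite F" "F \<subseteq> {a \<in> \<Lambda>. src' a = v}" "a0 \<in> F" "c a0 \<noteq> 0" "t \<in> \<Lambda>" "rng' t = v"
  shows "(\<Sum>a\<in>F. fa_smult (c a) (T (a0 \<cdot> t) \<odot> S (a \<cdot> t))) \<notin> I"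
proof
  let ?z = "\<Sum>a\<in>F. fa_smult (c a) (T (a0 \<cdot> t) \<odot> S (a \<cdot> t))"
  assume "?z \<in> I"
  then obtain N where N: "\<And>f. vanishes N (act ?z f)" using vanishes_ideal by blast
  let ?n = "\<lambda>i. if i < k then N else 0"
  have "in_Nk k ?n" by (simp add: in_Nk_def)
  \<comment> \<open>Because there are no sources, a path \<open>m\<close> with all coordinates equal
    to \<open>N\<close> starts at \<open>s(t)\<close>, and the vanishing must hold at it.\<close>
  then have "vLn G (src' t) ?n \<noteq> {}" using assms(5) by (intro vLn_nonempty) simp_all
  then obtain m where "m \<in> vLn G (src' t) ?n" by blast
  from vLnD[OF this] have m: "m \<in> \<Lambda>" "src' t = rng' m" "deg_ge N m"
    by (simp_all add: deg_ge_def)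
  have F: "a \<in> \<Lambda>" "src' a = rng' t" if "a \<in> F" for a using assms(2,6) that by auto
  define f where "f = (\<lambda>p. if p = m then 1 else 0 :: 'r)"
  \<comment> \<open>The value is that of \<open>actS (a t) f\<close> at \<open>a0 t m\<close>,
    nonzero only if \<open>a0 t m = a t m\<close>. Cancelling \<open>m\<close> and then
    \<open>t\<close> on the right forces \<open>a = a0\<close>.\<close>
  have eval: "act (T (a0 \<cdot> t) \<odot> S (a \<cdot> t)) f m = (if a = a0 then 1 else 0)" if a: "a \<in> F" for a
  proof -
    have p: "a0 \<cdot> t \<in> \<Lambda>" "a \<cdot> t \<in> \<Lambda>" "src' (a0 \<cdot> t) = rng' m" "src' (a \<cdot> t) = rng' m"
      using F[OF a] F[OF assms(3)] assms(5) m(1,2) by simp_all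
    have "act (T (a0 \<cdot> t) \<odot> S (a \<cdot> t)) f m = actS (a \<cdot> t) f (a0 \<cdot> t \<cdot> m)"
      using p m(1) by (simp add: act_mult act_S act_T actT_def)
    also have "\<dots> = (if a = a0 then 1 else 0)"
    proof (cases "a = a0")
      case True
      then show ?thesis using actS_cmp[OF p(2) m(1) p(4), of f] by (simp add: f_def)
    next
      case False
      show ?thesis
      proof (cases "extends (a0 \<cdot> t \<cdot> m) (a \<cdot> t)")
        case True
        then obtain q where q: "q \<in> \<Lambda>" "src' (a \<cdot> t) = rng' q" "a0 \<cdot> t \<cdot> m = a \<cdot> t \<cdot> q"
          unfolding extends_def by blast
        have "q \<noteq> m"
        proof
          assume "q = m"
          then have "a0 \<cdot> t = a \<cdot> t"
            using cmp_right_cancel[OF p(1) m(1) p(2,3,4)] q(3) by simp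
          then have "a0 = a"
            using cmp_right_cancel[of a0 t a] F[OF a] F[OF assms(3)] assms(5) by simp
          then show False using False by simp
        qed
        then show ?thesis
          unfolding q(3) using actS_cmp[OF p(2) q(1,2), of f] False by (simp add: f_def)
      qed (use False in \<open>simp add: actS_not_extends\<close>)
    qed
    finally show ?thesis .
  qed
  have C: "(T (a0 \<cdot> t) :: ('p, 'r) fa) \<odot> S (a \<cdot> t) \<in> C" if "a \<in> F" for a
    using F[OF that] F[OF assms(3)] assms(5) by simp
  have "act ?z f m = (\<Sum>a\<in>F. c a * act (T (a0 \<cdot> t) \<odot> S (a \<cdot> t)) f m)"
    using C by (simp add: act_sum act_smult)
  also have "\<dots> = (\<Sum>a\<in>F. if a = a0 then c a else 0)"
    by (intro sum.cong) (simp_all add: eval)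
  also have "\<dots> = c a0" using assms(1,3) by simp
  finally have "act ?z f m \<noteq> 0" using assms(4) by simp
  moreover have "act ?z f m = 0" using N[of f] m(1,3) unfolding vanishes_def by blast
  ultimately show False by simp
qed

section \<open>Compression into the cycline subalgebra\<close>

lemma compress_to_cycline:
  fixes x :: "('p, 'r::comm_ring_1) fa"
  assumes "x \<in> C" "x \<notin> I"
  shows "\<exists>y\<in>C. \<exists>z\<in>C. cycline (y \<odot> x \<odot> z) \<and> y \<odot> x \<odot> z \<notin> I"
proof -
  obtain N where N: "\<And>b. b \<in> \<Lambda> \<Longrightarrow> deg_ge N b \<Longrightarrow> spanned (src' b) (x \<odot> S b)"
    using mult_S_spanned[OF assms(1)] by blast
  obtain b where b: "b \<in> \<Lambda>" "deg_ge N b" "x \<odot> S b \<notin> I"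
    using ideal_if_mult_S[OF assms(1), of N] assms(2) by blast
  obtain F0 c where F0: "finite F0" "F0 \<subseteq> {a \<in> \<Lambda>. src' a = src' b}"
    "x \<odot> S b \<approx> (\<Sum>a\<in>F0. fa_smult (c a) (S a))"
    using N[OF b(1,2)] unfolding spanned_def by blast
  \<comment> \<open>Zero terms are discarded so that whichever \<open>a0\<close> is chosen has a
    nonzero coefficient.\<close>
  define F where "F = {a \<in> F0. c a \<noteq> 0}"
  have F: "finite F" "F \<subseteq> {a \<in> \<Lambda>. src' a = src' b}" using F0(1,2) by (auto simp: F_def)
  have "(\<Sum>a\<in>F0. fa_smult (c a) (S a)) = (\<Sum>a\<in>F. fa_smult (c a) (S a))"
    unfolding F_def using F0(1) by (intro sum.mono_neutral_right) auto
  then have xb: "x \<odot> S b \<approx> (\<Sum>a\<in>F. fa_smult (c a) (S a))" using F0(3) by simp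
  have "F \<noteq> {}" using xb b(3) by (auto simp: cong_zero_iff)
  then obtain a0 where a0: "a0 \<in> F" by blast
  then have c0: "c a0 \<noteq> 0" by (simp add: F_def)
  define L where "L t = {a \<in> F. meets (a0 \<cdot> t) (a \<cdot> t)}" for t
  have finL: "finite (L t)" for t using F(1) by (simp add: L_def)
  obtain t where t: "t \<in> \<Lambda>" "rng' t = src' b"
    and tmin: "\<And>u. u \<in> \<Lambda> \<Longrightarrow> rng' u = src' b \<Longrightarrow> card (L t) \<le> card (L u)"
    \<comment> \<open>The vertex \<open>s(b)\<close>, taken as a path, shows that there is a
      candidate to minimize over.\<close>
    using ex_has_least_nat[of "\<lambda>t. t \<in> \<Lambda> \<and> rng' t = src' b" "src' b" "\<lambda>t. card (L t)"] b(1)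
    by auto
  have Fa: "a \<in> \<Lambda>" "src' a = rng' t" if "a \<in> F" for a using F(2) t(2) that by auto
  have stable: "meets (a0 \<cdot> t \<cdot> d) (a \<cdot> t \<cdot> d)" if a: "a \<in> L t" and d: "d \<in> \<Lambda>" "rng' d = src' t" for a d
  proof -
    have as: "e \<cdot> t \<cdot> d = e \<cdot> (t \<cdot> d)" if "e \<in> F" for e
      using Fa[OF that] t(1) d by (simp add: cmp_assoc)
    \<comment> \<open>Lengthening \<open>t\<close> can only shrink \<open>L\<close>, since a common
      extension after appending \<open>d\<close> is already one before. With minimality of
      \<open>card (L t)\<close> the two sets coincide.\<close>
    have "L (t \<cdot> d) \<subseteq> L t"
    proof
      fix e assume "e \<in> L (t \<cdot> d)"
      then have e: "e \<in> F" "meets (a0 \<cdot> t \<cdot> d) (e \<cdot> t \<cdot> d)" by (auto simp: L_def as[OF a0] as)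
      then obtain p q where pq: "p \<in> \<Lambda>" "q \<in> \<Lambda>" "src' d = rng' p" "src' d = rng' q"
        "a0 \<cdot> t \<cdot> d \<cdot> p = e \<cdot> t \<cdot> d \<cdot> q"
        unfolding meets_def using Fa[OF a0] Fa[OF e(1)] t(1) d by auto
      then have "a0 \<cdot> t \<cdot> (d \<cdot> p) = e \<cdot> t \<cdot> (d \<cdot> q)"
        using Fa[OF a0] Fa[OF e(1)] t(1) d by (simp add: cmp_assoc[of "_ \<cdot> t"])
      moreover have "d \<cdot> p \<in> \<Lambda>" "d \<cdot> q \<in> \<Lambda>" "src' (a0 \<cdot> t) = rng' (d \<cdot> p)" "src' (e \<cdot> t) = rng' (d \<cdot> q)"
        using Fa[OF a0] Fa[OF e(1)] t(1) d pq(1-4) by simp_all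
      ultimately have "meets (a0 \<cdot> t) (e \<cdot> t)" unfolding meets_def by blast
      then show "e \<in> L t" using e(1) by (simp add: L_def)
    qed
    moreover have "card (L t) \<le> card (L (t \<cdot> d))" using t d by (intro tmin) simp_all
    ultimately have "L (t \<cdot> d) = L t" by (intro card_seteq finL)
    then have "a \<in> L (t \<cdot> d)" "a \<in> F" using a by (simp_all add: L_def)
    then show ?thesis using as[OF a0] as[of a] by (simp add: L_def)
  qed
  have at: "a \<cdot> t \<in> \<Lambda>" "src' (a \<cdot> t) = src' t" if "a \<in> F" for a
    using Fa[OF that] t(1) by simp_all
  let ?z = "\<Sum>a\<in>F. fa_smult (c a) (T (a0 \<cdot> t) \<odot> S (a \<cdot> t))"
  have "cycline (T (a0 \<cdot> t) \<odot> S (a \<cdot> t) :: ('p, 'r) fa)" if a: "a \<in> F" for a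
  proof (cases "a \<in> L t")
    case True
    then show ?thesis using at[OF a] at[OF a0] stable by (intro cycline_T_S) simp_all
  next
    case False
    then have "(T (a0 \<cdot> t) \<odot> S (a \<cdot> t) :: ('p, 'r) fa) \<approx> 0"
      using a at(1)[OF a] at(1)[OF a0] by (intro T_S_not_meets) (simp_all add: L_def)
    then show ?thesis
      using at(1)[OF a] at(1)[OF a0] by (intro cycline_cong[OF cycline_zero _ cong_sym]) simp_all
  qed
  then have z: "cycline ?z" by (intro cycline_sum cycline_smult)
  have z': "?z \<notin> I"
    using F a0 c0 t by (rule T_S_sum_not_ideal)
  let ?y = "T (a0 \<cdot> t) :: ('p, 'r) fa" and ?w = "S b \<odot> S t :: ('p, 'r) fa"
  have C: "?y \<in> C" "?w \<in> C" using at(1)[OF a0] b(1) t(1) by simp_all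
  \<comment> \<open>The compressing factors are s_{a0 t}* on the left and s_b s_t on the
    right.\<close>
  have "?y \<odot> x \<odot> ?w = ?y \<odot> (x \<odot> S b \<odot> S t)" by (simp add: fa_mult_assoc)
  also have "\<dots> \<approx> ?y \<odot> ((\<Sum>a\<in>F. fa_smult (c a) (S a)) \<odot> S t)"
    using C(1) t(1) by (intro cong_mult_left cong_mult_right xb) simp_all
  also have "\<dots> = (\<Sum>a\<in>F. fa_smult (c a) (?y \<odot> (S a \<odot> S t)))"
    by (simp add: fa_mult_sum_left fa_mult_sum_right fa_mult_smult_left fa_mult_smult_right)
  also have "\<dots> \<approx> ?z"
    using C(1) Fa t(1) by (intro cong_sum cong_smult cong_mult_left S_cmp) simp_all
  finally have eq: "?y \<odot> x \<odot> ?w \<approx> ?z" .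
  have "?y \<odot> x \<odot> ?w \<in> C" using C assms(1) by simp
  then have "cycline (?y \<odot> x \<odot> ?w)" using cycline_cong[OF z _ cong_sym[OF eq]] by simp
  moreover have "?y \<odot> x \<odot> ?w \<notin> I" using cong_ideal_iff[OF eq] z' by simp
  ultimately show ?thesis using C by blast
qed

section \<open>Transfer of injectivity to the whole algebra\<close>

lemma cycline_subalg_KP: "X \<in> cycline_subalg G k \<Longrightarrow> X \<in> KP G k"
proof (induction rule: cycline_subalg.induct)
  case (gen a b)
  then show ?case
    unfolding KP_def kp_ssstar_def cycline_pair_def by (intro imageI) simp
next
  case zero
  then show ?case by (simp add: kp_zero_def KP_def)
next
  case (add X Y)
  then show ?case by (auto simp: KP_def kp_add_cls)
next
  case (mult X Y)
  then show ?case by (auto simp: KP_def kp_mult_cls)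
next
  case (smult X c)
  then show ?case by (auto simp: KP_def kp_smult_cls)
qed

lemma inj_on_KP_iff:
  fixes Phi :: "('p, 'r::comm_ring_1) fa set \<Rightarrow> 'a::ring"
  assumes add: "\<forall>X\<in>KP G k. \<forall>Y\<in>KP G k. Phi (kp_add G k X Y) = Phi X + Phi Y"
    and mult: "\<forall>X\<in>KP G k. \<forall>Y\<in>KP G k. Phi (kp_mult G k X Y) = Phi X * Phi Y"
  shows "inj_on Phi (KP G k) \<longleftrightarrow> inj_on Phi (cycline_subalg G k)"
proof
  assume "inj_on Phi (KP G k)"
  then show "inj_on Phi (cycline_subalg G k)"
    by (rule inj_on_subset) (use cycline_subalg_KP in blast)
next
  assume inj: "inj_on Phi (cycline_subalg G k)"
  define p where "p x = Phi (cls x)" for x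
  have p_add: "p (x + y) = p x + p y" and p_mult: "p (x \<odot> y) = p x * p y" if "x \<in> C" "y \<in> C" for x y
    using add mult that by (auto simp: p_def KP_def kp_add_cls kp_mult_cls)
  have p_zero: "p 0 = 0" using p_add[of 0 0] by simp
  \<comment> \<open>The kernel of \<open>p\<close> is closed under multiplication on both sides, so
    it contains the compressed element. That element and zero both have classes in the cycline
    subalgebra, where injectivity identifies them.\<close>
  have ker: "x \<in> I" if x: "x \<in> C" "p x = 0" for x
  proof (rule ccontr)
    assume "x \<notin> I"
    then obtain y z where yz: "y \<in> C" "z \<in> C" "cycline (y \<odot> x \<odot> z)" "y \<odot> x \<odot> z \<notin> I"
      using compress_to_cycline[OF x(1)] by blast
    have "p (y \<odot> x \<odot> z) = 0" using yz(1,2) x by (simp add: p_mult)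
    then have "cls (y \<odot> x \<odot> z) = cls 0"
      using inj yz(3) cycline_zero p_zero unfolding inj_on_def p_def cycline_def by metis
    then show False using yz(4) by (simp add: cls_eq_iff cong_zero_iff)
  qed
  show "inj_on Phi (KP G k)"
  proof (rule inj_onI)
    fix X Y assume "X \<in> KP G k" "Y \<in> KP G k" and eq: "Phi X = Phi Y"
    then obtain x y where xy: "x \<in> C" "y \<in> C" "X = cls x" "Y = cls y" by (auto simp: KP_def)
    \<comment> \<open>Compatibility with subtraction is derived from additivity, by writing
      \<open>x\<close> as \<open>(x - y) + y\<close>.\<close>
    have "p (x - y) + p y = p x" using p_add[of "x - y" y] xy by simp
    then have "p (x - y) = 0" using eq xy by (simp add: p_def)
    then have "x - y \<in> I" using xy by (intro ker) simp_all
    then show "X = Y" using cls_eqI xy by (simp add: cong_def)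
  qed
qed

end

theorem theorem5p4:
  fixes G :: "'p kgraph" and k :: nat
    and Phi :: "('p, 'r::comm_ring_1) fa set \<Rightarrow> 'a::ring"
  assumes "is_kgraph G k"
    and "row_finite_no_sources G k"
    and "\<forall>X\<in>KP G k. \<forall>Y\<in>KP G k. Phi (kp_add G k X Y) = Phi X + Phi Y"
    and "\<forall>X\<in>KP G k. \<forall>Y\<in>KP G k. Phi (kp_mult G k X Y) = Phi X * Phi Y"
  shows "inj_on Phi (KP G k) \<longleftrightarrow> inj_on Phi (cycline_subalg G k)"
proof -
  interpret row_finite_kgraph G k using assms(1,2) by unfold_locales
  show ?thesis using assms(3,4) by (rule inj_on_KP_iff)
qed

end
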